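(* Let $K$ be an algebraically closed field of characteristic $0$ and let $n\ge 2$ be an integer. Let $\mathsf{F}_n[\mathcal{A}_2],\ \mathsf{F}_n[\mathcal{B}_2],\ \mathsf{F}_n[\mathcal{G}_2]:\mathbb{A}^2\to\mathbb{A}^2$ be the $n$th folding maps over $K$ associated to the simple Lie algebras $\mathcal{A}_2,\mathcal{B}_2,\mathcal{G}_2$. Then their affine automorphism groups are as follows: $$\operatorname{Aut}\bigl(\mathsf{F}_n[\mathcal{A}_2]\bigr)\cong\begin{cases}\mathcal{S}_3&\text{if } n\equiv 1\pmod 3,\\ \boldsymbol{\mu}_2&\text{if } n\not\equiv 1\pmod 3,\end{cases}$$ $$\operatorname{Aut}\bigl(\mathsf{F}_n[\mathcal{B}_2]\bigr)\cong\begin{cases}\boldsymbol{\mu}_2&\text{if } n\equiv 1\pmod 2,\\ 1&\text{if } n\equiv 0\pmod 2,\end{cases}$$ $$\operatorname{Aut}\bigl(\mathsf{F}_n[\mathcal{G}_2]\bigr)\cong 1.$$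
   Context: For a polynomial map $f:\mathbb{A}^2\to\mathbb{A}^2$ over $K$, $\operatorname{Aut}(f)$ denotes the affine automorphism group of $f$, i.e. the group (under composition) of affine automorphisms $\varphi(x,y)=(ax+by+c,\,dx+ey+f_0)$, with coefficients in $K$ and $ae-bd\ne0$, satisfying $\varphi^{-1}\circ f\circ\varphi=f$. $\mathcal{S}_3$ is the symmetric group on 3 letters, $\boldsymbol{\mu}_2$ is the cyclic group of order 2. In each of the three cases the folding map is written $(X_n,Y_n)$ with $X_n,Y_n\in\mathbb{Z}[x,y]$, and is given explicitly by the following initial values and recursion. Case $\mathcal{A}_2$: $(X_0,Y_0)=(3,0)$, $(X_1,Y_1)=(x,y)$, $(X_2,Y_2)=(x^2-y^2-2x,\ 2xy+2y)$, and for $n\ge3$ $$X_n=x(X_{n-1}-X_{n-2})-y(Y_{n-1}+Y_{n-2})+X_{n-3},\qquad Y_n=x(Y_{n-1}-Y_{n-2})+y(X_{n-1}+X_{n-2})+Y_{n-3}.$$ (Equivalently, with $z=x+iy$, $\bar z=x-iy$ and $A_n=X_n+iY_n$: $A_0=3$, $A_1=z$, $A_2=z^2-2\bar z$, $A_n=zA_{n-1}-\bar zA_{n-2}+A_{n-3}$.) Case $\mathcal{B}_2$: $(X_0,Y_0)=(4,4)$, $(X_1,Y_1)=(x,y)$, $(X_2,Y_2)=(x^2-2y-4,\ y^2-2x^2+4y+4)$, $(X_3,Y_3)=(x^3-3xy-3x,\ y^3-3x^2y+6y^2+9y)$, and for $n\ge0$ $$X_{n+4}=x(X_{n+3}+X_{n+1})-(2+y)X_{n+2}-X_n,\qquad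 Y_{n+4}=y(Y_{n+3}+Y_{n+1})-(x^2-2y-2)Y_{n+2}-Y_n.$$ Case $\mathcal{G}_2$: $X_0=6$, $Y_0=6$; $X_1=x$, $Y_1=y$; $X_2=x^2-2x-2y-6$, $Y_2=-2x^3+6xy+y^2+18x+10y+18$; $X_3=x^3-3xy-9x-6y-12$, $Y_3=-3x^3y-6x^3+9xy^2+y^3+45xy+18y^2+54x+63y+60$; $X_4=x^4-4x^2y-10x^2-4xy+2y^2-8x+8y+6$, $Y_4=2x^6-12x^4y-4x^3y^2-36x^4-28x^3y+18x^2y^2+12xy^3+y^4-40x^3+108x^2y+120xy^2+24y^3+162x^2+372xy+134y^2+360x+280y+198$; $X_5=x^5-5x^3y-15x^3-5x^2y+5xy^2-10x^2+35xy+10y^2+55x+50y+60$, $Y_5=5x^6y+10x^6-30x^4y^2-5x^3y^3-150x^4y-65x^3y^2+45x^2y^3+15xy^4+y^5-180x^4-205x^3y+360x^2y^2+240xy^3+30y^4-190x^3+945x^2y+1200xy^2+255y^3+810x^2+2415xy+920y^2+1710x+1495y+900$; and for $n\ge0$ $$X_{n+6}=x(X_{n+5}+X_{n+1})-(x+y+3)(X_{n+4}+X_{n+2})+(x^2-2y-4)X_{n+3}-X_n,$$ $$Y_{n+6}=y(Y_{n+5}+Y_{n+1})-(x^3-3xy-9x-5y-9)(Y_{n+4}+Y_{n+2})+(y^2-2x^3+6xy+18x+12y+20)Y_{n+3}-Y_n.$$ *)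

theory Defs
  imports
    "HOL-Algebra.Sym_Groups"
    "HOL-Algebra.Elementary_Groups"
    "HOL-Computational_Algebra.Polynomial"
    "HOL-Number_Theory.Cong"
begin

section \<open>The folding polynomials\<close>

text \<open>
  \<open>\<int>[x,y]\<close> is rendered as \<open>\<int>[x][y]\<close>, i.e. \<^typ>\<open>int poly poly\<close>: the inner
  variable is \<open>x\<close>, the outer one is \<open>y\<close>.
\<close>

abbreviation vx :: "int poly poly" where "vx \<equiv> [:[:0, 1:]:]"
abbreviation vy :: "int poly poly" where "vy \<equiv> [:0, 1:]"

fun A2_X :: "nat \<Rightarrow> int poly poly" and A2_Y :: "nat \<Rightarrow> int poly poly" where
  "A2_X 0 = 3"
| "A2_X (Suc 0) = vx"
| "A2_X (Suc (Suc 0)) = vx^2 - vy^2 - 2*vx"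
| "A2_X (Suc (Suc (Suc n))) =
     vx * (A2_X (Suc (Suc n)) - A2_X (Suc n)) - vy * (A2_Y (Suc (Suc n)) + A2_Y (Suc n)) + A2_X n"
| "A2_Y 0 = 0"
| "A2_Y (Suc 0) = vy"
| "A2_Y (Suc (Suc 0)) = 2*vx*vy + 2*vy"
| "A2_Y (Suc (Suc (Suc n))) =
     vx * (A2_Y (Suc (Suc n)) - A2_Y (Suc n)) + vy * (A2_X (Suc (Suc n)) + A2_X (Suc n)) + A2_Y n"

fun B2_X :: "nat \<Rightarrow> int poly poly" where
  "B2_X 0 = 4"
| "B2_X (Suc 0) = vx"
| "B2_X (Suc (Suc 0)) = vx^2 - 2*vy - 4"
| "B2_X (Suc (Suc (Suc 0))) = vx^3 - 3*vx*vy - 3*vx"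
| "B2_X (Suc (Suc (Suc (Suc n)))) =
     vx * (B2_X (Suc (Suc (Suc n))) + B2_X (Suc n)) - (2 + vy) * B2_X (Suc (Suc n)) - B2_X n"

fun B2_Y :: "nat \<Rightarrow> int poly poly" where
  "B2_Y 0 = 4"
| "B2_Y (Suc 0) = vy"
| "B2_Y (Suc (Suc 0)) = vy^2 - 2*vx^2 + 4*vy + 4"
| "B2_Y (Suc (Suc (Suc 0))) = vy^3 - 3*vx^2*vy + 6*vy^2 + 9*vy"
| "B2_Y (Suc (Suc (Suc (Suc n)))) =
     vy * (B2_Y (Suc (Suc (Suc n))) + B2_Y (Suc n)) - (vx^2 - 2*vy - 2) * B2_Y (Suc (Suc n)) - B2_Y n"

fun G2_X :: "nat \<Rightarrow> int poly poly" where
  "G2_X 0 = 6"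
| "G2_X (Suc 0) = vx"
| "G2_X (Suc (Suc 0)) = vx^2 - 2*vx - 2*vy - 6"
| "G2_X (Suc (Suc (Suc 0))) = vx^3 - 3*vx*vy - 9*vx - 6*vy - 12"
| "G2_X (Suc (Suc (Suc (Suc 0)))) =
     vx^4 - 4*vx^2*vy - 10*vx^2 - 4*vx*vy + 2*vy^2 - 8*vx + 8*vy + 6"
| "G2_X (Suc (Suc (Suc (Suc (Suc 0))))) =
     vx^5 - 5*vx^3*vy - 15*vx^3 - 5*vx^2*vy + 5*vx*vy^2 - 10*vx^2 + 35*vx*vy + 10*vy^2
     + 55*vx + 50*vy + 60"
| "G2_X (Suc (Suc (Suc (Suc (Suc (Suc n)))))) =
     vx * (G2_X (Suc (Suc (Suc (Suc (Suc n))))) + G2_X (Suc n))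
     - (vx + vy + 3) * (G2_X (Suc (Suc (Suc (Suc n)))) + G2_X (Suc (Suc n)))
     + (vx^2 - 2*vy - 4) * G2_X (Suc (Suc (Suc n)))
     - G2_X n"

fun G2_Y :: "nat \<Rightarrow> int poly poly" where
  "G2_Y 0 = 6"
| "G2_Y (Suc 0) = vy"
| "G2_Y (Suc (Suc 0)) = -2*vx^3 + 6*vx*vy + vy^2 + 18*vx + 10*vy + 18"
| "G2_Y (Suc (Suc (Suc 0))) =
     -3*vx^3*vy - 6*vx^3 + 9*vx*vy^2 + vy^3 + 45*vx*vy + 18*vy^2 + 54*vx + 63*vy + 60"
| "G2_Y (Suc (Suc (Suc (Suc 0)))) =
     2*vx^6 - 12*vx^4*vy - 4*vx^3*vy^2 - 36*vx^4 - 28*vx^3*vy + 18*vx^2*vy^2 + 12*vx*vy^3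
     + vy^4 - 40*vx^3 + 108*vx^2*vy + 120*vx*vy^2 + 24*vy^3 + 162*vx^2 + 372*vx*vy
     + 134*vy^2 + 360*vx + 280*vy + 198"
| "G2_Y (Suc (Suc (Suc (Suc (Suc 0))))) =
     5*vx^6*vy + 10*vx^6 - 30*vx^4*vy^2 - 5*vx^3*vy^3 - 150*vx^4*vy - 65*vx^3*vy^2
     + 45*vx^2*vy^3 + 15*vx*vy^4 + vy^5 - 180*vx^4 - 205*vx^3*vy + 360*vx^2*vy^2
     + 240*vx*vy^3 + 30*vy^4 - 190*vx^3 + 945*vx^2*vy + 1200*vx*vy^2 + 255*vy^3
     + 810*vx^2 + 2415*vx*vy + 920*vy^2 + 1710*vx + 1495*vy + 900"
| "G2_Y (Suc (Suc (Suc (Suc (Suc (Suc n)))))) =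
     vy * (G2_Y (Suc (Suc (Suc (Suc (Suc n))))) + G2_Y (Suc n))
     - (vx^3 - 3*vx*vy - 9*vx - 5*vy - 9) * (G2_Y (Suc (Suc (Suc (Suc n)))) + G2_Y (Suc (Suc n)))
     + (vy^2 - 2*vx^3 + 6*vx*vy + 18*vx + 12*vy + 20) * G2_Y (Suc (Suc (Suc n)))
     - G2_Y n"


section \<open>The folding maps over a field\<close>

text \<open>
  A polynomial map \<open>\<A>\<^sup>2 \<rightarrow> \<A>\<^sup>2\<close> over \<open>K\<close> is represented by the function it induces on
  \<open>K \<times> K\<close>. This loses nothing over an infinite field, in particular over an algebraically closed
  one, since polynomials inducing the same function are equal.
\<close>

definition eval2 :: "int poly poly \<Rightarrow> 'a::comm_ring_1 \<Rightarrow> 'a \<Rightarrow> 'a" where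
  "eval2 p x y = poly (map_poly (\<lambda>q. poly (map_poly of_int q) x) p) y"

definition poly_map2 :: "int poly poly \<Rightarrow> int poly poly \<Rightarrow> 'a \<times> 'a \<Rightarrow> 'a::comm_ring_1 \<times> 'a" where
  "poly_map2 P Q = (\<lambda>(x, y). (eval2 P x y, eval2 Q x y))"

definition fold_A2 :: "nat \<Rightarrow> 'a \<times> 'a \<Rightarrow> 'a::field \<times> 'a" where
  "fold_A2 n = poly_map2 (A2_X n) (A2_Y n)"

definition fold_B2 :: "nat \<Rightarrow> 'a \<times> 'a \<Rightarrow> 'a::field \<times> 'a" where
  "fold_B2 n = poly_map2 (B2_X n) (B2_Y n)"

definition fold_G2 :: "nat \<Rightarrow> 'a \<times> 'a \<Rightarrow> 'a::field \<times> 'a" where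
  "fold_G2 n = poly_map2 (G2_X n) (G2_Y n)"


section \<open>Affine automorphism groups\<close>

definition affine_auts :: "('a \<times> 'a \<Rightarrow> 'a::field \<times> 'a) set" where
  "affine_auts = {\<phi>. \<exists>a b c d e g. a * e - b * d \<noteq> 0 \<and>
     \<phi> = (\<lambda>(x, y). (a * x + b * y + c, d * x + e * y + g))}"

definition Aut :: "('a \<times> 'a \<Rightarrow> 'a \<times> 'a) \<Rightarrow> ('a \<times> 'a \<Rightarrow> 'a::field \<times> 'a) monoid" where
  "Aut f = \<lparr>carrier = {\<phi> \<in> affine_auts. inv' \<phi> \<circ> f \<circ> \<phi> = f}, mult = (\<circ>), one = id\<rparr>"

lemma affine_auts_id: "id \<in> affine_auts"
  unfolding affine_auts_def
  by (rule CollectI, rule exI[of _ 1], rule exI[of _ 0], rule exI[of _ 0],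
      rule exI[of _ 0], rule exI[of _ 1], rule exI[of _ 0]) auto

lemma affine_auts_comp:
  assumes "\<phi> \<in> affine_auts" "\<psi> \<in> affine_auts"
  shows "\<phi> \<circ> \<psi> \<in> affine_auts"
proof -
  obtain a b c d e g where 1: "a * e - b * d \<noteq> 0"
    "\<phi> = (\<lambda>(x, y). (a * x + b * y + c, d * x + e * y + g))"
    using assms(1) unfolding affine_auts_def by blast
  obtain a' b' c' d' e' g' where 2: "a' * e' - b' * d' \<noteq> 0"
    "\<psi> = (\<lambda>(x, y). (a' * x + b' * y + c', d' * x + e' * y + g'))"
    using assms(2) unfolding affine_auts_def by blast
  have "(a*a' + b*d') * (d*b' + e*e') - (a*b' + b*e') * (d*a' + e*d')
      = (a * e - b * d) * (a' * e' - b' * d')"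
    by (simp add: algebra_simps)
  then have "(a*a' + b*d') * (d*b' + e*e') - (a*b' + b*e') * (d*a' + e*d') \<noteq> 0"
    using 1(1) 2(1) by simp
  moreover have "\<phi> \<circ> \<psi> = (\<lambda>(x, y). ((a*a' + b*d') * x + (a*b' + b*e') * y + (a*c' + b*g' + c),
      (d*a' + e*d') * x + (d*b' + e*e') * y + (d*c' + e*g' + g)))"
    by (auto simp: 1(2) 2(2) fun_eq_iff algebra_simps)
  ultimately show ?thesis
    unfolding affine_auts_def by blast
qed

lemma affine_auts_inverse:
  assumes "\<phi> \<in> affine_auts"
  obtains \<psi> where "\<psi> \<in> affine_auts" "\<psi> \<circ> \<phi> = id" "\<phi> \<circ> \<psi> = id"
proof -
  obtain a b c d e g where 1: "a * e - b * d \<noteq> 0"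
    "\<phi> = (\<lambda>(x, y). (a * x + b * y + c, d * x + e * y + g))"
    using assms unfolding affine_auts_def by blast
  define D where "D = a * e - b * d"
  define \<psi> where "\<psi> = (\<lambda>(x, y). ((e/D) * x + (-b/D) * y + (b*g - e*c)/D,
                                  (-d/D) * x + (a/D) * y + (d*c - a*g)/D))"
  have D: "D \<noteq> 0" using 1 D_def by simp
  have "(e/D) * (a/D) - (-b/D) * (-d/D) = 1/D"
    using D by (simp add: field_simps) (simp add: D_def algebra_simps)
  then have "(e/D) * (a/D) - (-b/D) * (-d/D) \<noteq> 0" using D by simp
  then have "\<psi> \<in> affine_auts" unfolding affine_auts_def \<psi>_def by blast
  moreover have "\<psi> \<circ> \<phi> = id" "\<phi> \<circ> \<psi> = id"
    using D by (auto simp: \<psi>_def 1(2) fun_eq_iff field_simps) (simp_all add: D_def algebra_simps)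
  ultimately show ?thesis using that by blast
qed

lemma affine_auts_bij: "\<phi> \<in> affine_auts \<Longrightarrow> bij \<phi>"
  by (metis affine_auts_inverse o_bij)

lemma Aut_iff_commute:
  assumes "\<phi> \<in> affine_auts"
  shows "inv' \<phi> \<circ> f \<circ> \<phi> = f \<longleftrightarrow> f \<circ> \<phi> = \<phi> \<circ> f"
  using affine_auts_bij[OF assms]
  by (metis (no_types, lifting) bij_is_inj bij_is_surj comp_assoc id_comp inv_o_cancel surj_iff)

lemma group_Aut: "group (Aut f)"
proof (rule groupI)
  fix \<phi> \<psi> assume "\<phi> \<in> carrier (Aut f)" "\<psi> \<in> carrier (Aut f)"
  then have a: "\<phi> \<in> affine_auts" "\<psi> \<in> affine_auts" "f \<circ> \<phi> = \<phi> \<circ> f" "f \<circ> \<psi> = \<psi> \<circ> f"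
    by (auto simp: Aut_def Aut_iff_commute)
  have "f \<circ> (\<phi> \<circ> \<psi>) = (\<phi> \<circ> \<psi>) \<circ> f"
    using a(3,4) by (metis comp_assoc)
  then show "\<phi> \<otimes>\<^bsub>Aut f\<^esub> \<psi> \<in> carrier (Aut f)"
    using affine_auts_comp[OF a(1,2)] by (simp add: Aut_def Aut_iff_commute)
next
  fix \<phi> assume "\<phi> \<in> carrier (Aut f)"
  then have a: "\<phi> \<in> affine_auts" "f \<circ> \<phi> = \<phi> \<circ> f"
    by (auto simp: Aut_def Aut_iff_commute)
  obtain \<psi> where p: "\<psi> \<in> affine_auts" "\<psi> \<circ> \<phi> = id" "\<phi> \<circ> \<psi> = id"
    using affine_auts_inverse[OF a(1)] .
  have "f \<circ> \<psi> = \<psi> \<circ> f"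
    using a(2) p(2,3) by (metis comp_assoc comp_id id_comp)
  then show "\<exists>\<psi>\<in>carrier (Aut f). \<psi> \<otimes>\<^bsub>Aut f\<^esub> \<phi> = \<one>\<^bsub>Aut f\<^esub>"
    using p by (intro bexI[of _ \<psi>]) (auto simp: Aut_def Aut_iff_commute)
qed (auto simp: Aut_def affine_auts_id comp_assoc)

end

(*
  The polynomials are homogenised with an extra variable t, so that an affine map commuting with
  a folding map gives an identity of polynomials in t; comparing the coefficients of low order
  determines the affine map.

  A_2: in the coordinates z = x + iy, w = x - iy the map is (z^n - n t z^(n-2) w + ..., same with
  z, w exchanged). The leading part makes the linear part diagonal or antidiagonal, and order t
  gives no translation, diag(a, a^2) with a^(n-1) = 1 and, by symmetry, a = a^4.

  B_2: the leading part is (x^n, D_n(y, x^2)) with D_n the Dickson polynomial, so the linear part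
  is diag(a, e). Order t gives x -> ax, e = a^2 and y -> e (y + 2) - 2. The line y = -2 is thus
  preserved, and on it the first component is x^n + n x^(n-2) + ..., whence a^2 = 1.

  G_2: with x of weight 2 and y of weight 3 the leading part is (x^n, D_n(y, x^3)), which excludes
  y from the first component and later gives a = 1. The usual grading gives e = a^2 and d = ac;
  the next weighted order gives c = 0, and order t^2 of the first component the last coefficient.
*)

theory Submission
  imports Defs
begin

text \<open>The field is infinite, so the value at 0 is determined by the others. The identities
  compared below arise after a division by \<tau>, so they are only available for nonzero
  \<tau>.\<close>

lemma poly_eqI_nonzero:
  fixes p q :: "'a::field_char_0 poly"
  assumes "\<And>\<tau>. \<tau> \<noteq> 0 \<Longrightarrow> poly p \<tau> = poly q \<tau>"
  shows "p = q"
proof (rule ccontr)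
  assume "p \<noteq> q"
  then have "finite {\<tau>. poly (p - q) \<tau> = 0}" by (intro poly_roots_finite) simp
  moreover have "UNIV - {0} \<subseteq> {\<tau>. poly (p - q) \<tau> = 0}" using assms by auto
  ultimately have "finite (UNIV - {0::'a})" by (rule rev_finite_subset)
  then show False by (simp add: infinite_UNIV_char_0)
qed

lemma coeff_mult_1: "coeff (p * q) (Suc 0) = coeff p 0 * coeff q (Suc 0) + coeff p (Suc 0) * coeff q 0"
  by (simp add: coeff_mult)

lemma coeff_power_1:
  "coeff (p ^ Suc n) (Suc 0) = of_nat (Suc n) * coeff p 0 ^ n * coeff p (Suc 0)"
  for p :: "'a::comm_ring_1 poly"
  by (induction n) (simp_all add: coeff_mult_1 coeff_mult_0 coeff_0_power algebra_simps)

section \<open>Evaluation of bivariate integer polynomials\<close>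

lemma poly_map_of_int_add [simp]:
  "poly (map_poly of_int (p + q)) x = poly (map_poly of_int p) x + (poly (map_poly of_int q) x :: 'a::comm_ring_1)"
  by (induction p q rule: poly_induct2) (simp_all add: map_poly_pCons algebra_simps)

lemma poly_map_of_int_smult [simp]:
  "poly (map_poly of_int (smult c q)) x = of_int c * (poly (map_poly of_int q) x :: 'a::comm_ring_1)"
  by (induction q) (simp_all add: map_poly_pCons algebra_simps)

lemma poly_map_of_int_mult [simp]:
  "poly (map_poly of_int (p * q)) x = poly (map_poly of_int p) x * (poly (map_poly of_int q) x :: 'a::comm_ring_1)"
  by (induction p) (simp_all add: map_poly_pCons algebra_simps)

lemma eval2_0 [simp]: "eval2 0 x y = 0"
  by (simp add: eval2_def)

lemma eval2_pCons [simp]: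
  "eval2 (pCons q p) x y = poly (map_poly of_int q) x + y * eval2 p x y"
  by (simp add: eval2_def map_poly_pCons)

lemma eval2_add [simp]: "eval2 (p + q) x y = eval2 p x y + eval2 q x y"
  by (induction p q rule: poly_induct2) (simp_all add: algebra_simps)

lemma eval2_smult: "eval2 (smult c q) x y = poly (map_poly of_int c) x * eval2 q x y"
  by (induction q) (simp_all add: algebra_simps)

lemma eval2_mult [simp]: "eval2 (p * q) x y = eval2 p x y * eval2 q x y"
  by (induction p) (simp_all add: eval2_smult algebra_simps)

lemma eval2_1 [simp]: "eval2 1 x y = 1"
  by (simp add: one_pCons map_poly_pCons)

lemma eval2_uminus [simp]: "eval2 (- p) x y = - eval2 p x y"
  using eval2_add[of p "- p" x y] by (simp add: eq_neg_iff_add_eq_0 add.commute)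

lemma eval2_diff [simp]: "eval2 (p - q) x y = eval2 p x y - eval2 q x y"
  by (simp only: diff_conv_add_uminus eval2_add eval2_uminus)

lemma eval2_power [simp]: "eval2 (p ^ n) x y = eval2 p x y ^ n"
  by (induction n) simp_all

lemma eval2_of_nat [simp]: "eval2 (of_nat n) x y = of_nat n"
  by (induction n) simp_all

lemma eval2_numeral [simp]: "eval2 (numeral n) x y = numeral n"
  by (metis eval2_of_nat of_nat_numeral)

lemma eval2_vx [simp]: "eval2 vx x y = x"
  by (simp add: map_poly_pCons)

lemma eval2_vy [simp]: "eval2 vy x y = y"
  by (simp add: map_poly_pCons)

lemmas eval2_simps = eval2_add eval2_diff eval2_uminus eval2_mult eval2_power eval2_numeral
  eval2_vx eval2_vy

section \<open>Homogenised families\<close>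

text \<open>The Dickson polynomial of the first kind: its value is u^n + v^n when s = u + v and q =
  u v.\<close>

fun dickson :: "nat \<Rightarrow> 'a::comm_ring_1 \<Rightarrow> 'a \<Rightarrow> 'a" where
  "dickson 0 s q = 2"
| "dickson (Suc 0) s q = s"
| "dickson (Suc (Suc n)) s q = s * dickson (Suc n) s q - q * dickson n s q"

text \<open>One family serves both components, since the conjugate of A_n is obtained by exchanging
  \<open>z\<close> and \<open>w\<close>. The powers of \<open>t\<close> make it homogeneous of
  degree n.\<close>

fun A2_hom :: "nat \<Rightarrow> 'a::comm_ring_1 \<Rightarrow> 'a \<Rightarrow> 'a \<Rightarrow> 'a" where
  "A2_hom 0 t z w = 3"
| "A2_hom (Suc 0) t z w = z"
| "A2_hom (Suc (Suc 0)) t z w = z^2 - 2*t*w"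
| "A2_hom (Suc (Suc (Suc n))) t z w =
     z * A2_hom (Suc (Suc n)) t z w - t*w * A2_hom (Suc n) t z w + t^3 * A2_hom n t z w"

fun B2_hom_X :: "nat \<Rightarrow> 'a::comm_ring_1 \<Rightarrow> 'a \<Rightarrow> 'a \<Rightarrow> 'a" where
  "B2_hom_X 0 t x y = 4"
| "B2_hom_X (Suc 0) t x y = x"
| "B2_hom_X (Suc (Suc 0)) t x y = x^2 - 2*t*y - 4*t^2"
| "B2_hom_X (Suc (Suc (Suc 0))) t x y = x^3 - 3*t*x*y - 3*t^2*x"
| "B2_hom_X (Suc (Suc (Suc (Suc n)))) t x y =
     x * (B2_hom_X (Suc (Suc (Suc n))) t x y + t^2 * B2_hom_X (Suc n) t x y)
     - t * (2*t + y) * B2_hom_X (Suc (Suc n)) t x y - t^4 * B2_hom_X n t x y"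

fun B2_hom_Y :: "nat \<Rightarrow> 'a::comm_ring_1 \<Rightarrow> 'a \<Rightarrow> 'a \<Rightarrow> 'a" where
  "B2_hom_Y 0 t x y = 4"
| "B2_hom_Y (Suc 0) t x y = y"
| "B2_hom_Y (Suc (Suc 0)) t x y = y^2 - 2*x^2 + 4*t*y + 4*t^2"
| "B2_hom_Y (Suc (Suc (Suc 0))) t x y = y^3 - 3*x^2*y + 6*t*y^2 + 9*t^2*y"
| "B2_hom_Y (Suc (Suc (Suc (Suc n)))) t x y =
     y * (B2_hom_Y (Suc (Suc (Suc n))) t x y + t^2 * B2_hom_Y (Suc n) t x y)
     - (x^2 - 2*t*y - 2*t^2) * B2_hom_Y (Suc (Suc n)) t x y - t^4 * B2_hom_Y n t x y"

fun G2_hom_X :: "nat \<Rightarrow> 'a::comm_ring_1 \<Rightarrow> 'a \<Rightarrow> 'a \<Rightarrow> 'a" where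
  "G2_hom_X 0 t x y = 6"
| "G2_hom_X (Suc 0) t x y = x"
| "G2_hom_X (Suc (Suc 0)) t x y = x^2 - 2*t*x - 2*t*y - 6*t^2"
| "G2_hom_X (Suc (Suc (Suc 0))) t x y = x^3 - 3*t*x*y - 9*t^2*x - 6*t^2*y - 12*t^3"
| "G2_hom_X (Suc (Suc (Suc (Suc 0)))) t x y =
     x^4 - 4*t*x^2*y - 10*t^2*x^2 - 4*t^2*x*y + 2*t^2*y^2 - 8*t^3*x + 8*t^3*y + 6*t^4"
| "G2_hom_X (Suc (Suc (Suc (Suc (Suc 0))))) t x y =
     x^5 - 5*t*x^3*y - 15*t^2*x^3 - 5*t^2*x^2*y + 5*t^2*x*y^2 - 10*t^3*x^2 + 35*t^3*x*y
     + 10*t^3*y^2 + 55*t^4*x + 50*t^4*y + 60*t^5"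
| "G2_hom_X (Suc (Suc (Suc (Suc (Suc (Suc n)))))) t x y =
     x * (G2_hom_X (Suc (Suc (Suc (Suc (Suc n))))) t x y + t^4 * G2_hom_X (Suc n) t x y)
     - t * (x + y + 3*t) * (G2_hom_X (Suc (Suc (Suc (Suc n)))) t x y + t^2 * G2_hom_X (Suc (Suc n)) t x y)
     + t * (x^2 - 2*t*y - 4*t^2) * G2_hom_X (Suc (Suc (Suc n))) t x y
     - t^6 * G2_hom_X n t x y"

text \<open>
  Here \<open>x\<close> has weight 2, \<open>y\<close> weight 3 and \<open>G2_Y n\<close> weight \<open>3 * n\<close>; in the other families both variables
  have weight 1.
\<close>

fun G2_hom_Y :: "nat \<Rightarrow> 'a::comm_ring_1 \<Rightarrow> 'a \<Rightarrow> 'a \<Rightarrow> 'a" where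
  "G2_hom_Y 0 t x y = 6"
| "G2_hom_Y (Suc 0) t x y = y"
| "G2_hom_Y (Suc (Suc 0)) t x y =
     -2*x^3 + 6*t*x*y + y^2 + 18*t^4*x + 10*t^3*y + 18*t^6"
| "G2_hom_Y (Suc (Suc (Suc 0))) t x y =
     -3*x^3*y - 6*t^3*x^3 + 9*t*x*y^2 + y^3 + 45*t^4*x*y + 18*t^3*y^2 + 54*t^7*x + 63*t^6*y
     + 60*t^9"
| "G2_hom_Y (Suc (Suc (Suc (Suc 0)))) t x y =
     2*x^6 - 12*t*x^4*y - 4*x^3*y^2 - 36*t^4*x^4 - 28*t^3*x^3*y + 18*t^2*x^2*y^2 + 12*t*x*y^3
     + y^4 - 40*t^6*x^3 + 108*t^5*x^2*y + 120*t^4*x*y^2 + 24*t^3*y^3 + 162*t^8*x^2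
     + 372*t^7*x*y + 134*t^6*y^2 + 360*t^10*x + 280*t^9*y + 198*t^12"
| "G2_hom_Y (Suc (Suc (Suc (Suc (Suc 0))))) t x y =
     5*x^6*y + 10*t^3*x^6 - 30*t*x^4*y^2 - 5*x^3*y^3 - 150*t^4*x^4*y - 65*t^3*x^3*y^2
     + 45*t^2*x^2*y^3 + 15*t*x*y^4 + y^5 - 180*t^7*x^4 - 205*t^6*x^3*y + 360*t^5*x^2*y^2
     + 240*t^4*x*y^3 + 30*t^3*y^4 - 190*t^9*x^3 + 945*t^8*x^2*y + 1200*t^7*x*y^2 + 255*t^6*y^3
     + 810*t^11*x^2 + 2415*t^10*x*y + 920*t^9*y^2 + 1710*t^13*x + 1495*t^12*y + 900*t^15"
| "G2_hom_Y (Suc (Suc (Suc (Suc (Suc (Suc n)))))) t x y =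
     y * (G2_hom_Y (Suc (Suc (Suc (Suc (Suc n))))) t x y + t^12 * G2_hom_Y (Suc n) t x y)
     - (x^3 - 3*t*x*y - 9*t^4*x - 5*t^3*y - 9*t^6)
       * (G2_hom_Y (Suc (Suc (Suc (Suc n)))) t x y + t^6 * G2_hom_Y (Suc (Suc n)) t x y)
     + t^3 * (y^2 - 2*x^3 + 6*t*x*y + 18*t^4*x + 12*t^3*y + 20*t^6) * G2_hom_Y (Suc (Suc (Suc n))) t x y
     - t^18 * G2_hom_Y n t x y"

lemma nat_induct_012_3:
  assumes "P 0" "P (Suc 0)" "P (Suc (Suc 0))"
    and "\<And>n. P n \<Longrightarrow> P (Suc n) \<Longrightarrow> P (Suc (Suc n)) \<Longrightarrow> P (Suc (Suc (Suc n)))"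
  shows "P n"
proof -
  have "P n \<and> P (Suc n) \<and> P (Suc (Suc n))"
    by (induction n) (use assms in auto)
  then show ?thesis ..
qed

text \<open>With a square root \<open>i\<close> of -1 in the ring, the coupled recursions of the two
  components combine linearly into the single recursion of \<open>A2_hom\<close>. Here
  \<open>x + i*y\<close> and \<open>x - i*y\<close> play the roles of z and its conjugate.\<close>

lemma eval2_A2:
  assumes "i^2 = (-1 :: 'a::comm_ring_1)"
  shows "eval2 (A2_X n) x y + i * eval2 (A2_Y n) x y = A2_hom n 1 (x + i*y) (x - i*y)"
    and "eval2 (A2_X n) x y - i * eval2 (A2_Y n) x y = A2_hom n 1 (x - i*y) (x + i*y)"
proof -
  have ii: "i * i = -1" using assms by (simp add: power2_eq_square)
  have iiu: "i * (i * u) = - u" for u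
    using ii by (metis mult.assoc mult_minus1)
  have "eval2 (A2_X n) x y + i * eval2 (A2_Y n) x y = A2_hom n 1 (x + i*y) (x - i*y)
    \<and> eval2 (A2_X n) x y - i * eval2 (A2_Y n) x y = A2_hom n 1 (x - i*y) (x + i*y)"
  proof (induction n rule: nat_induct_012_3)
    case 3
    show ?case
      by (simp only: eval2_simps A2_X.simps A2_Y.simps A2_hom.simps)
         (simp add: ii iiu power2_eq_square algebra_simps)
  next
    case (4 n)
    show ?case
      unfolding A2_hom.simps 4[THEN conjunct1, symmetric] 4[THEN conjunct2, symmetric]
        A2_X.simps A2_Y.simps eval2_simps
      by (simp add: ii iiu algebra_simps)
  next
    case 1
    show ?case by (simp add: eval2_numeral)
  next
    case 2
    show ?case by (simp only: eval2_simps A2_X.simps A2_Y.simps A2_hom.simps)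
  qed
  then show "eval2 (A2_X n) x y + i * eval2 (A2_Y n) x y = A2_hom n 1 (x + i*y) (x - i*y)"
    and "eval2 (A2_X n) x y - i * eval2 (A2_Y n) x y = A2_hom n 1 (x - i*y) (x + i*y)" by auto
qed

lemma eval2_B2_X: "eval2 (B2_X n) x y = B2_hom_X n 1 x y"
  by (induction n rule: B2_X.induct)
     (simp_all only: eval2_simps B2_X.simps B2_hom_X.simps power_one mult_1_left mult_1_right)

lemma eval2_B2_Y: "eval2 (B2_Y n) x y = B2_hom_Y n 1 x y"
  by (induction n rule: B2_Y.induct)
     (simp_all only: eval2_simps B2_Y.simps B2_hom_Y.simps power_one mult_1_left mult_1_right)

lemma eval2_G2_X: "eval2 (G2_X n) x y = G2_hom_X n 1 x y"
  by (induction n rule: G2_X.induct)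
     (simp_all only: eval2_simps G2_X.simps G2_hom_X.simps power_one mult_1_left mult_1_right)

lemma eval2_G2_Y: "eval2 (G2_Y n) x y = G2_hom_Y n 1 x y"
  by (induction n rule: G2_Y.induct)
     (simp_all only: eval2_simps G2_Y.simps G2_hom_Y.simps power_one mult_1_left mult_1_right)

text \<open>The families are also applied to univariate polynomials, that is, along curves with
  parameter \<tau>; evaluation at \<tau> leads back to their values.\<close>

lemma poly_dickson: "poly (dickson n p q) \<tau> = dickson n (poly p \<tau>) (poly q \<tau>)"
  by (induction n p q rule: dickson.induct) simp_all

lemma poly_A2_hom: "poly (A2_hom n t x y) \<tau> = A2_hom n (poly t \<tau>) (poly x \<tau>) (poly y \<tau>)"
  by (induction n t x y rule: A2_hom.induct) simp_all

lemma poly_B2_hom_X: "poly (B2_hom_X n t x y) \<tau> = B2_hom_X n (poly t \<tau>) (poly x \<tau>) (poly y \<tau>)"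
  by (induction n t x y rule: B2_hom_X.induct) simp_all

lemma poly_B2_hom_Y: "poly (B2_hom_Y n t x y) \<tau> = B2_hom_Y n (poly t \<tau>) (poly x \<tau>) (poly y \<tau>)"
  by (induction n t x y rule: B2_hom_Y.induct) simp_all

lemma poly_G2_hom_X: "poly (G2_hom_X n t x y) \<tau> = G2_hom_X n (poly t \<tau>) (poly x \<tau>) (poly y \<tau>)"
  by (induction n t x y rule: G2_hom_X.induct) simp_all

lemma poly_G2_hom_Y: "poly (G2_hom_Y n t x y) \<tau> = G2_hom_Y n (poly t \<tau>) (poly x \<tau>) (poly y \<tau>)"
  by (induction n t x y rule: G2_hom_Y.induct) simp_all


section \<open>Homogeneity of the families\<close>

lemma A2_hom_scale: "A2_hom n (s*t) (s*x) (s*y) = s^n * A2_hom n t x y"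
  by (induction n t x y rule: A2_hom.induct) (simp_all add: algebra_simps power_mult_distrib eval_nat_numeral)

lemma B2_hom_X_scale: "B2_hom_X n (s*t) (s*x) (s*y) = s^n * B2_hom_X n t x y"
  by (induction n t x y rule: B2_hom_X.induct) (simp_all add: algebra_simps power_mult_distrib eval_nat_numeral)

lemma B2_hom_Y_scale: "B2_hom_Y n (s*t) (s*x) (s*y) = s^n * B2_hom_Y n t x y"
  by (induction n t x y rule: B2_hom_Y.induct) (simp_all add: algebra_simps power_mult_distrib eval_nat_numeral)

lemma G2_hom_X_scale: "G2_hom_X n (s*t) (s*x) (s*y) = s^n * G2_hom_X n t x y"
  by (induction n t x y rule: G2_hom_X.induct) (simp_all add: algebra_simps power_mult_distrib eval_nat_numeral)

lemma G2_hom_Y_scale: "G2_hom_Y n (s*t) (s^2*x) (s^3*y) = s^(3*n) * G2_hom_Y n t x y"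
  by (induction n t x y rule: G2_hom_Y.induct) (simp_all add: algebra_simps power_mult_distrib eval_nat_numeral)

section \<open>Coefficients of low order\<close>

lemma coeff_numeral_0 [simp]: "coeff (numeral k) 0 = numeral k"
  and coeff_numeral_Suc [simp]: "coeff (numeral k) (Suc n) = 0"
  by (simp_all add: numeral_poly)

lemma coeff_mult_2: "coeff (p * q) (Suc (Suc 0)) = coeff p 0 * coeff q (Suc (Suc 0))
  + coeff p (Suc 0) * coeff q (Suc 0) + coeff p (Suc (Suc 0)) * coeff q 0"
  by (simp add: coeff_mult)

lemmas coeff_simps = coeff_mult_0 coeff_mult_1 coeff_mult_2 eval_nat_numeral algebra_simps

text \<open>To first order the t^3 term drops out and the recursion reads A_(n+1) = z A_n - t w
  A_(n-1), so A_n is z^n - n t z^(n-2) w. The indices start at 2, where this expression first makes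
  sense.\<close>

lemma A2_hom_coeff:
  fixes t z w :: "'a::comm_ring_1 poly"
  assumes "coeff t 0 = 0" "coeff t (Suc 0) = 1"
  shows "coeff (A2_hom (Suc (Suc n)) t z w) 0 = coeff z 0 ^ Suc (Suc n) \<and>
    coeff (A2_hom (Suc (Suc n)) t z w) (Suc 0) =
      of_nat (Suc (Suc n)) * (coeff z 0 ^ Suc n * coeff z (Suc 0) - coeff z 0 ^ n * coeff w 0)"
proof (induction n rule: induct_nat_012)
  case (ge2 n)
  show ?case unfolding A2_hom.simps(4)[of "Suc n"]
    using assms by (simp add: ge2 coeff_simps del: A2_hom.simps)
qed (use assms in \<open>simp_all add: coeff_simps\<close>)

text \<open>Modulo q^2 the Dickson polynomial is s^n - n s^(n-2) q.\<close>

lemma dickson_coeff: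
  fixes s q :: "'a::comm_ring_1 poly"
  assumes "coeff q 0 = 0"
  shows "coeff (dickson (Suc (Suc n)) s q) 0 = coeff s 0 ^ Suc (Suc n) \<and>
    coeff (dickson (Suc (Suc n)) s q) (Suc 0) =
      of_nat (Suc (Suc n)) * (coeff s 0 ^ Suc n * coeff s (Suc 0) - coeff s 0 ^ n * coeff q (Suc 0))"
proof (induction n rule: induct_nat_012)
  case (ge2 n)
  show ?case unfolding dickson.simps(3)[of "Suc (Suc n)"]
    using assms by (simp add: ge2 coeff_simps del: dickson.simps)
qed (use assms in \<open>simp_all add: coeff_simps\<close>)

text \<open>To first order only \<open>x\<close> times the preceding member and
  \<open>- t * y\<close> times the one before it survive in the recursion, which is the same pattern
  as for A_2.\<close>

lemma B2_hom_X_coeff: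
  fixes t x y :: "'a::comm_ring_1 poly"
  assumes "coeff t 0 = 0" "coeff t (Suc 0) = 1"
  shows "coeff (B2_hom_X (Suc (Suc n)) t x y) 0 = coeff x 0 ^ Suc (Suc n) \<and>
    coeff (B2_hom_X (Suc (Suc n)) t x y) (Suc 0) =
      of_nat (Suc (Suc n)) * (coeff x 0 ^ Suc n * coeff x (Suc 0) - coeff x 0 ^ n * coeff y 0)"
proof (induction n rule: induct_nat_012)
  case (ge2 n)
  show ?case unfolding B2_hom_X.simps(5)
    using assms by (simp add: ge2 coeff_simps del: B2_hom_X.simps)
qed (use assms in \<open>simp_all add: coeff_simps\<close>)

text \<open>At t = 0 the recursion becomes that of D_n(y, x^2). Index 0 is left out, as the two
  initial values there are 4 and 2.\<close>

lemma B2_hom_Y_coeff_0: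
  fixes t x y :: "'a::comm_ring_1 poly"
  assumes "coeff t 0 = 0" 
  shows "coeff (B2_hom_Y (Suc n) t x y) 0 = dickson (Suc n) (coeff y 0) (coeff x 0 ^ 2)"
proof (induction n rule: nat_induct_012_3)
  case (4 n)
  show ?case unfolding B2_hom_Y.simps(5) dickson.simps(3)[of "Suc (Suc n)"]
    using assms by (simp add: 4 coeff_simps del: B2_hom_Y.simps dickson.simps)
qed (use assms in \<open>simp_all add: coeff_simps\<close>)

text \<open>To first order the second component on x = 0 agrees with (y + 2 t)^n, so y + 2 is the
  natural coordinate on that line.\<close>

lemma B2_hom_Y_0_coeff:
  fixes t y :: "'a::comm_ring_1 poly"
  assumes "coeff t 0 = 0" "coeff t (Suc 0) = 1"
  shows "coeff (B2_hom_Y (Suc (Suc n)) t 0 y) 0 = coeff y 0 ^ Suc (Suc n) \<and>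
    coeff (B2_hom_Y (Suc (Suc n)) t 0 y) (Suc 0) =
      of_nat (Suc (Suc n)) * coeff y 0 ^ Suc n * (coeff y (Suc 0) + 2)"
proof (induction n rule: induct_nat_012)
  case (ge2 n)
  show ?case unfolding B2_hom_Y.simps(5)
    using assms by (simp add: ge2 coeff_simps del: B2_hom_Y.simps)
qed (use assms in \<open>simp_all add: coeff_simps\<close>)

text \<open>On y = -2 t the factor 2 t + y vanishes, and up to order t^2 the recursion is X_(n+4) =
  x (X_(n+3) + t^2 X_(n+1)). The formula begins at index 3: at index 2 the coefficient of t^2 is
  0.\<close>

lemma B2_hom_X_coeff_2:
  fixes a :: "'a::comm_ring_1"
  shows "coeff (B2_hom_X (Suc (Suc (Suc n))) [:0, 1:] [:a:] [:0, -2:]) 0 = a ^ Suc (Suc (Suc n)) \<and>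
    coeff (B2_hom_X (Suc (Suc (Suc n))) [:0, 1:] [:a:] [:0, -2:]) (Suc 0) = 0 \<and>
    coeff (B2_hom_X (Suc (Suc (Suc n))) [:0, 1:] [:a:] [:0, -2:]) (Suc (Suc 0)) =
      of_nat (Suc (Suc (Suc n))) * a ^ Suc n"
proof (induction n rule: induct_nat_012)
  case (ge2 n)
  show ?case unfolding B2_hom_X.simps(5)[of "Suc n"]
    by (simp add: ge2 B2_hom_X_coeff coeff_simps del: B2_hom_X.simps)
qed (simp_all add: coeff_simps)

section \<open>Coefficients of low order for G_2\<close>

lemma nat_induct_012345_6:
  assumes "P 0" "P (Suc 0)" "P (Suc (Suc 0))" "P (Suc (Suc (Suc 0)))" "P (Suc (Suc (Suc (Suc 0))))"
    "P (Suc (Suc (Suc (Suc (Suc 0)))))"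
    and "\<And>n. P n \<Longrightarrow> P (Suc n) \<Longrightarrow> P (Suc (Suc n)) \<Longrightarrow> P (Suc (Suc (Suc n)))
      \<Longrightarrow> P (Suc (Suc (Suc (Suc n)))) \<Longrightarrow> P (Suc (Suc (Suc (Suc (Suc n)))))
      \<Longrightarrow> P (Suc (Suc (Suc (Suc (Suc (Suc n))))))"
  shows "P n"
proof -
  have "P n \<and> P (Suc n) \<and> P (Suc (Suc n)) \<and> P (Suc (Suc (Suc n)))
    \<and> P (Suc (Suc (Suc (Suc n)))) \<and> P (Suc (Suc (Suc (Suc (Suc n)))))"
    by (induction n) (use assms in auto)
  then show ?thesis ..
qed

lemma coeff_power_less:
  fixes p :: "'a::comm_ring_1 poly"
  assumes "coeff p 0 = 0" "m < k"
  shows "coeff (p ^ k) m = 0"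
  using assms(2)
proof (induction k arbitrary: m)
  case (Suc k)
  have "coeff p i * coeff (p ^ k) (m - i) = 0" if "i \<le> m" for i
    using Suc that assms(1) by (cases "i = 0") auto
  then show ?case by (simp add: coeff_mult)
qed simp

text \<open>Reads off the coefficient of a power with numeral exponent without expanding it; the G_2
  families contain such powers up to t^18.\<close>

lemma coeff_power_numeral_1:
  fixes p :: "'a::comm_ring_1 poly"
  shows "coeff (p ^ numeral k) (Suc 0) = numeral k * coeff p 0 ^ pred_numeral k * coeff p (Suc 0)"
  using coeff_power_1[of p "pred_numeral k"]
  by (metis numeral_eq_Suc of_nat_numeral)

lemmas coeff_simps_numeral = coeff_add coeff_diff coeff_minus coeff_mult_0 coeff_mult_1
  coeff_0_power coeff_power_numeral_1 coeff_numeral_0 coeff_numeral_Suc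

text \<open>To first order the contributions - t x X_(n+4) and t x^2 X_(n+3) to the recursion
  cancel, which leaves the pattern x^n - n t x^(n-2) y. Only index 2 carries an extra - 2 t x. The
  linear coefficient of \<open>t\<close> is left free, so that both gradings are covered: there
  \<open>t\<close> is the variable or its cube.\<close>

lemma G2_hom_X_coeff:
  fixes t x y :: "'a::comm_ring_1 poly"
  assumes "coeff t 0 = 0"
  shows "coeff (G2_hom_X (Suc (Suc n)) t x y) 0 = coeff x 0 ^ Suc (Suc n) \<and>
    coeff (G2_hom_X (Suc (Suc n)) t x y) (Suc 0) =
      of_nat (Suc (Suc n)) * (coeff x 0 ^ Suc n * coeff x (Suc 0) - coeff t (Suc 0) * coeff x 0 ^ n * coeff y 0)
      - (if n = 0 then 2 * coeff t (Suc 0) * coeff x 0 else 0)"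
proof (induction n rule: nat_induct_012345_6)
  case (7 n)
  show ?case unfolding G2_hom_X.simps(7)[of "Suc (Suc n)"] coeff_simps_numeral
    by (simp add: 7 assms zero_power algebra_simps eval_nat_numeral del: G2_hom_X.simps)
qed (simp only: G2_hom_X.simps coeff_simps_numeral,
     simp add: assms zero_power algebra_simps eval_nat_numeral)+

text \<open>The first-order term - n t x^(n-2) y turns y = g t into a contribution - n g at order
  t^2. Comparing with y = 0 avoids computing the rest of that coefficient.\<close>

lemma G2_hom_X_coeff_2:
  fixes g :: "'a::comm_ring_1"
  shows "coeff (G2_hom_X (Suc (Suc n)) [:0, 1:] 1 [:0, g:]) (Suc (Suc 0)) =
    coeff (G2_hom_X (Suc (Suc n)) [:0, 1:] 1 0) (Suc (Suc 0)) - of_nat (Suc (Suc n)) * g"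
proof (induction n rule: nat_induct_012345_6)
  case (7 n)
  have 1: "coeff (G2_hom_X (Suc (Suc m)) [:0, 1:] 1 [:0, g:]) 0 = 1"
     "coeff (G2_hom_X (Suc (Suc m)) [:0, 1:] 1 [:0, g:]) (Suc 0) = (if m = 0 then -2 else 0)"
     "coeff (G2_hom_X (Suc (Suc m)) [:0, 1::'a:] 1 0) 0 = 1"
     "coeff (G2_hom_X (Suc (Suc m)) [:0, 1::'a:] 1 0) (Suc 0) = (if m = 0 then -2 else 0)" for m
    using G2_hom_X_coeff[of "[:0, 1:]" m 1 "[:0, g:]"] G2_hom_X_coeff[of "[:0, 1::'a:]" m 1 0]
    by (auto simp del: G2_hom_X.simps)
  have 2: "coeff ([:0, 1::'a:] ^ 2) (Suc (Suc 0)) = 1"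
    by (simp add: power2_eq_square)
  show ?case unfolding G2_hom_X.simps(7)[of "Suc (Suc n)"] coeff_simps_numeral coeff_mult_2
    by (simp add: 7 1 2 coeff_power_less zero_power algebra_simps del: G2_hom_X.simps)
qed (simp add: eval_nat_numeral algebra_simps)+

text \<open>At t = 0 the recursion becomes that of D_n(y, x^3). Index 0 is left out, as the two
  initial values there are 6 and 2.\<close>

lemma G2_hom_Y_coeff_0:
  fixes t x y :: "'a::comm_ring_1 poly"
  assumes "coeff t 0 = 0"
  shows "coeff (G2_hom_Y (Suc n) t x y) 0 = dickson (Suc n) (coeff y 0) (coeff x 0 ^ 3)"
proof (induction n rule: nat_induct_012345_6)
  case (7 n)
  show ?case unfolding G2_hom_Y.simps(7)[of "Suc n"] dickson.simps(3)[of "Suc (Suc (Suc (Suc (Suc n))))"]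
    coeff_simps_numeral
    by (simp add: 7 assms zero_power del: G2_hom_Y.simps dickson.simps)
qed (simp_all only: G2_hom_Y.simps coeff_simps_numeral,
     simp_all add: assms zero_power algebra_simps eval_nat_numeral)

text \<open>The base point is s = 2, q = 1, where D_n has the value 2 and the derivative n^2 in s; a
  first-order deviation \<open>c\<close> of y therefore appears with the factor n^2. The arguments
  have the shape of the weighted curves along which commuting maps are compared.\<close>

lemma G2_hom_Y_coeff_1:
  fixes c :: "'a::comm_ring_1"
  shows "coeff (G2_hom_Y (Suc n) [:0, 1:] [:1, 0, c':] [:2, c, 0, g:]) 0 = 2 \<and>
   coeff (G2_hom_Y (Suc n) [:0, 1:] [:1, 0, c':] [:2, c, 0, g:]) (Suc 0) =
    of_nat (Suc n)^2 * (c + 6) - 6 * of_nat (Suc n)"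
proof (induction n rule: nat_induct_012345_6)
  case (7 n)
  show ?case unfolding G2_hom_Y.simps(7)[of "Suc n"] coeff_simps_numeral
    by (simp add: 7 zero_power algebra_simps power2_eq_square del: G2_hom_Y.simps)
qed (simp_all only: G2_hom_Y.simps coeff_simps_numeral,
     simp_all add: zero_power algebra_simps eval_nat_numeral)

lemma dickson_0 [simp]: "dickson (Suc n) s 0 = s ^ Suc n"
  by (induction n) simp_all

lemma dickson_2_1 [simp]: "dickson n 2 1 = (2 :: 'a::comm_ring_1)"
  by (induction n rule: induct_nat_012) simp_all

lemma coeff_X_power_0 [simp]: "coeff ([:0, 1:] ^ Suc n) 0 = 0"
  by (simp add: coeff_mult_0)

lemma coeff_X_power_1 [simp]: "coeff ([:0, 1:] ^ Suc (Suc n)) (Suc 0) = (0 :: 'a::comm_ring_1)"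
  by (rule coeff_power_less) simp_all

text \<open>Serves to exclude b \<noteq> 0: at s = 2, q = 1, where every D_n is 2, the leading parts
  would force 2^n = 2.\<close>

lemma two_power_Suc_Suc_neq: "(2::'a::field_char_0) ^ Suc (Suc n) \<noteq> 2"
proof
  assume "(2::'a) ^ Suc (Suc n) = 2"
  then have "(2::'a) ^ Suc n = 1" by simp
  then have "of_nat (2 ^ Suc n) = (of_nat 1 :: 'a)" by simp
  then have "2 ^ Suc n = (1::nat)" by (rule of_nat_eq_iff[THEN iffD1])
  then show False by simp
qed

section \<open>Affine maps commuting with the folding maps\<close>

text \<open>For \<tau> \<noteq> 0 the hypothesis is applied at (p(\<tau>)/\<tau>, q(\<tau>)/\<tau>)
  and multiplied by \<tau>^n. Translations acquire a factor \<tau>, so they enter one order after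
  the linear part.\<close>

lemma B2_hom_X_commute_poly:
  fixes a :: "'a::field_char_0"
  assumes "\<And>x y. B2_hom_X n 1 (a*x + b*y + c) (d*x + e*y + g) = a * B2_hom_X n 1 x y + b * B2_hom_Y n 1 x y + c"
  shows "B2_hom_X n [:0, 1:] (smult a p + smult b q + [:0, c:]) (smult d p + smult e q + [:0, g:])
    = smult a (B2_hom_X n [:0, 1:] p q) + smult b (B2_hom_Y n [:0, 1:] p q) + smult c ([:0, 1:] ^ n)"
proof (rule poly_eqI_nonzero)
  fix \<tau> :: 'a assume \<tau>: "\<tau> \<noteq> 0"
  define x y where "x = poly p \<tau> / \<tau>" "y = poly q \<tau> / \<tau>"
  have xy: "poly p \<tau> = \<tau> * x" "poly q \<tau> = \<tau> * y" using \<tau> by (simp_all add: x_y_def)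
  have "B2_hom_X n (\<tau> * 1) (\<tau> * (a*x + b*y + c)) (\<tau> * (d*x + e*y + g))
    = a * B2_hom_X n (\<tau> * 1) (\<tau> * x) (\<tau> * y) + b * B2_hom_Y n (\<tau> * 1) (\<tau> * x) (\<tau> * y) + c * \<tau>^n"
    unfolding B2_hom_X_scale B2_hom_Y_scale assms by (simp add: algebra_simps)
  then show "poly (B2_hom_X n [:0, 1:] (smult a p + smult b q + [:0, c:]) (smult d p + smult e q + [:0, g:])) \<tau>
    = poly (smult a (B2_hom_X n [:0, 1:] p q) + smult b (B2_hom_Y n [:0, 1:] p q) + smult c ([:0, 1:] ^ n)) \<tau>"
    by (simp add: poly_B2_hom_X poly_B2_hom_Y xy algebra_simps)
qed

lemma B2_hom_Y_commute_poly:
  fixes a :: "'a::field_char_0"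
  assumes "\<And>x y. B2_hom_Y n 1 (a*x + b*y + c) (d*x + e*y + g) = d * B2_hom_X n 1 x y + e * B2_hom_Y n 1 x y + g"
  shows "B2_hom_Y n [:0, 1:] (smult a p + smult b q + [:0, c:]) (smult d p + smult e q + [:0, g:])
    = smult d (B2_hom_X n [:0, 1:] p q) + smult e (B2_hom_Y n [:0, 1:] p q) + smult g ([:0, 1:] ^ n)"
proof (rule poly_eqI_nonzero)
  fix \<tau> :: 'a assume \<tau>: "\<tau> \<noteq> 0"
  define x y where "x = poly p \<tau> / \<tau>" "y = poly q \<tau> / \<tau>"
  have xy: "poly p \<tau> = \<tau> * x" "poly q \<tau> = \<tau> * y" using \<tau> by (simp_all add: x_y_def)
  have "B2_hom_Y n (\<tau> * 1) (\<tau> * (a*x + b*y + c)) (\<tau> * (d*x + e*y + g))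
    = d * B2_hom_X n (\<tau> * 1) (\<tau> * x) (\<tau> * y) + e * B2_hom_Y n (\<tau> * 1) (\<tau> * x) (\<tau> * y) + g * \<tau>^n"
    unfolding B2_hom_X_scale B2_hom_Y_scale assms by (simp add: algebra_simps)
  then show "poly (B2_hom_Y n [:0, 1:] (smult a p + smult b q + [:0, c:]) (smult d p + smult e q + [:0, g:])) \<tau>
    = poly (smult d (B2_hom_X n [:0, 1:] p q) + smult e (B2_hom_Y n [:0, 1:] p q) + smult g ([:0, 1:] ^ n)) \<tau>"
    by (simp add: poly_B2_hom_X poly_B2_hom_Y xy algebra_simps)
qed

lemma B2_affine_commute:
  fixes a b c d e g :: "'a::field_char_0" and m :: nat
  defines "n \<equiv> Suc (Suc m)"
  assumes det: "a * e - b * d \<noteq> 0"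
    and X: "\<And>x y. B2_hom_X n 1 (a*x + b*y + c) (d*x + e*y + g) = a * B2_hom_X n 1 x y + b * B2_hom_Y n 1 x y + c"
    and Y: "\<And>x y. B2_hom_Y n 1 (a*x + b*y + c) (d*x + e*y + g) = d * B2_hom_X n 1 x y + e * B2_hom_Y n 1 x y + g"
  shows "b = 0" "c = 0" "d = 0" "e = 1" "g = 0" "a ^ Suc m = 1" "a^2 = 1"
proof -
  note PX = B2_hom_X_commute_poly[OF X] and PY = B2_hom_Y_commute_poly[OF Y]
  have n0: "of_nat n \<noteq> (0::'a)" by (simp add: n_def del: of_nat_Suc)
  have BX: "coeff (B2_hom_X n [:0, 1:] p q) 0 = coeff p 0 ^ n"
     "coeff (B2_hom_X n [:0, 1:] p q) (Suc 0) =
        of_nat n * (coeff p 0 ^ Suc m * coeff p (Suc 0) - coeff p 0 ^ m * coeff q 0)" for p q :: "'a poly"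
    unfolding n_def using B2_hom_X_coeff[of "[:0, 1:]" m p q] by simp_all
  have BY: "coeff (B2_hom_Y n [:0, 1:] p q) 0 = dickson n (coeff q 0) (coeff p 0 ^ 2)" for p q :: "'a poly"
    unfolding n_def using B2_hom_Y_coeff_0[of "[:0, 1:]" "Suc m" p q] by simp
  have BY0: "coeff (B2_hom_Y n [:0, 1:] 0 q) (Suc 0) = of_nat n * coeff q 0 ^ Suc m * (coeff q (Suc 0) + 2)"
    for q :: "'a poly"
    unfolding n_def using B2_hom_Y_0_coeff[of "[:0, 1:]" m q] by simp
  have Tn: "coeff ([:0, 1:] ^ n) 0 = (0::'a)" "coeff ([:0, 1:] ^ n) (Suc 0) = (0::'a)"
    unfolding n_def by (rule coeff_X_power_0 coeff_X_power_1)+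
  have zn: "(0::'a) ^ n = 0" by (simp add: n_def)
  \<comment> \<open>At order 0 the translations disappear, and the linear part has to be compatible
    with the leading forms.\<close>
  have L1: "(a*x + b*y) ^ n = a * x^n + b * dickson n y (x^2)" for x y
    using arg_cong[OF PX[of "[:x:]" "[:y:]"], of "\<lambda>p. coeff p 0"] by (simp add: BX BY Tn mult.commute)
  have L2: "dickson n (d*x + e*y) ((a*x)^2 + 0) = d * x^n + e * dickson n y (x^2)" if "b = 0" for x y
    using arg_cong[OF PY[of "[:x:]" "[:y:]"], of "\<lambda>p. coeff p 0"] that by (simp add: BX BY Tn mult.commute)
  have DT: "coeff (dickson n p [:0, 0, k:]) 0 = coeff p 0 ^ n"
     "coeff (dickson n p [:0, 0, k:]) (Suc 0) = of_nat n * (coeff p 0 ^ Suc m * coeff p (Suc 0))"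
    for p and k :: 'a
    unfolding n_def using dickson_coeff[of "[:0, 0, k:]" m p] by simp_all
  show b: "b = 0"
  proof (rule ccontr)
    assume b: "b \<noteq> 0"
    \<comment> \<open>\<open>L1\<close> at y = 1, read as an identity of polynomials in x. The
      Dickson term depends on x^2 only, so the linear coefficient gives n b^(n-1) a = 0.\<close>
    have "[:b, a:] ^ n = smult a ([:0, 1:] ^ n) + smult b (dickson n 1 ([:0, 0, 1:]))"
      by (rule poly_ext) (use L1[where y = 1] in \<open>simp add: poly_dickson power2_eq_square algebra_simps\<close>)
    from arg_cong[OF this, of "\<lambda>p. coeff p 0"] arg_cong[OF this, of "\<lambda>p. coeff p (Suc 0)"]
    have *: "b ^ n = b" "coeff ([:b, a:] ^ n) (Suc 0) = 0"
      by (simp_all add: DT Tn coeff_0_power zn)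
    then have "a = 0" using coeff_power_1[of "[:b, a:]" "Suc m"] n0 b by (simp add: n_def del: of_nat_Suc power_Suc)
    \<comment> \<open>D_n(2, 1) = 2, so at x = 1, y = 2 the identity becomes (2 b)^n = 2 b.\<close>
    with L1[of 1 2] *(1) b have "(2::'a) ^ n = 2" by (simp add: power_mult_distrib)
    then show False using two_power_Suc_Suc_neq unfolding n_def by blast
  qed
  from det b have ae: "a \<noteq> 0" "e \<noteq> 0" by auto
  \<comment> \<open>The same comparison for the second component: the linear coefficient is n
    e^(n-1) d on the left and 0 on the right.\<close>
  have "dickson n [:e, d:] ([:0, 0, a^2:]) = smult d ([:0, 1:] ^ n) + smult e (dickson n 1 ([:0, 0, 1:]))"
    by (rule poly_ext) (use L2[OF b, where y = 1] in \<open>simp add: poly_dickson power2_eq_square algebra_simps\<close>)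
  from arg_cong[OF this, of "\<lambda>p. coeff p 0"] arg_cong[OF this, of "\<lambda>p. coeff p (Suc 0)"]
  have e: "e ^ n = e" and d: "d = 0"
    using n0 ae by (simp_all add: DT Tn coeff_0_power zn)
  then show "d = 0" by simp
  have e': "e ^ Suc m = 1" using e ae by (simp add: n_def)
  \<comment> \<open>Order t along x = 1 with y constant. The values y = 0 and y = 1 then give c = 0
    and e = a^2.\<close>
  have X1: "a ^ Suc m * c - a^m * (e*y) = - (a * y)" for y
  proof -
    have "of_nat n * (a ^ Suc m * c - a^m * (e*y)) = of_nat n * (- (a * y))"
      using arg_cong[OF PX[of "1" "[:y:]"], of "\<lambda>p. coeff p (Suc 0)"] b d by (simp add: BX BY Tn)
    then show ?thesis using n0 by (metis mult_left_cancel)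
  qed
  from X1[of 0] ae show c: "c = 0" by simp
  from X1[of 1] c have ame: "a^m * e = a" by simp
  have "a ^ n = a" using L1[of 1 0] b by simp
  then show am: "a ^ Suc m = 1" using ae by (simp add: n_def)
  have ea: "e = a^2" using ame am by (metis mult.assoc mult.left_neutral power2_eq_square power_Suc)
  \<comment> \<open>Order t on the line x = 0, which the map preserves because b = c = 0; the
    starting point is y = 1.\<close>
  have "of_nat n * e ^ Suc m * (g + 2) = e * (of_nat n * 2)"
    using arg_cong[OF PY[of 0 1], of "\<lambda>p. coeff p (Suc 0)"] b c d by (simp add: BY0 Tn del: power_Suc)
  then have "of_nat n * (g + 2) = of_nat n * (2 * e)" unfolding e' by (simp add: mult.commute mult.left_commute)
  then have g: "g + 2 = 2 * e" using n0 by (metis mult_left_cancel)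
  show a2: "a^2 = 1"
  \<comment> \<open>For n = 2 the relation a^(n-1) = 1 already reads a = 1. This case is apart
    because the expansion on y = -2 t begins at index 3.\<close>
  proof (cases m)
    case 0
    then show ?thesis using am by simp
  next
    case (Suc k)
    \<comment> \<open>The relation g + 2 = 2 e says exactly that the line y = -2 is preserved, so
      order t^2 along it compares n a^(n-2) with n a.\<close>
    have "smult e [:0, - 2:] + [:0, g:] = [:0, -2:]" using g by (simp add: algebra_simps)
    then have "B2_hom_X n [:0, 1:] [:a:] [:0, -2:] = smult a (B2_hom_X n [:0, 1:] [:1:] [:0, -2:])"
      using PX[of 1 "[:0, -2:]"] b c d by (simp add: one_pCons)
    from arg_cong[OF this, of "\<lambda>p. coeff p (Suc (Suc 0))"]
    have "of_nat n * a ^ Suc k = of_nat n * a"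
      using B2_hom_X_coeff_2[of k a] B2_hom_X_coeff_2[of k "1::'a"] by (simp add: n_def Suc del: of_nat_Suc)
    then have "a ^ m = a" unfolding Suc using n0 by (metis mult_left_cancel)
    then show ?thesis using am by (simp add: power2_eq_square)
  qed
  then show e1: "e = 1" using ea by simp
  then show "g = 0" using g by simp
qed

section \<open>Affine maps commuting with the folding maps of G_2\<close>

text \<open>
  Restriction to the curves \<open>x = r / \<tau>\<^sup>2\<close>, \<open>y = s / \<tau>\<^sup>3\<close>, after multiplication by \<open>\<tau>\<close> to the power \<open>3 * n\<close>.
\<close>

lemma G2_hom_commute_weighted_X:
  fixes a :: "'a::field_char_0"
  assumes "\<And>x y. G2_hom_X n 1 (a*x + b*y + c) (d*x + e*y + g) = a * G2_hom_X n 1 x y + b * G2_hom_Y n 1 x y + c"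
  shows "G2_hom_X n [:0, 0, 0, 1:] [:b*s, a*r, 0, c:] [:e*s, d*r, 0, g:]
    = smult a (G2_hom_X n [:0, 0, 0, 1:] [:0, r:] [:s:]) + smult b (G2_hom_Y n [:0, 1:] [:r:] [:s:])
      + smult c ([:0, 1:] ^ (3*n))"
proof (rule poly_eqI_nonzero)
  fix \<tau> :: 'a assume \<tau>: "\<tau> \<noteq> 0"
  define x y where "x = r / \<tau>^2" "y = s / \<tau>^3"
  have xy: "r = \<tau>^2 * x" "s = \<tau>^3 * y" using \<tau> by (simp_all add: x_y_def)
  have "G2_hom_X n (\<tau>^3 * 1) (\<tau>^3 * (a*x + b*y + c)) (\<tau>^3 * (d*x + e*y + g))
    = a * G2_hom_X n (\<tau>^3 * 1) (\<tau>^3 * x) (\<tau>^3 * y) + b * G2_hom_Y n (\<tau> * 1) (\<tau>^2 * x) (\<tau>^3 * y) + c * \<tau>^(3*n)"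
    unfolding G2_hom_X_scale G2_hom_Y_scale assms by (simp add: algebra_simps flip: power_mult)
  then show "poly (G2_hom_X n [:0, 0, 0, 1:] [:b*s, a*r, 0, c:] [:e*s, d*r, 0, g:]) \<tau>
    = poly (smult a (G2_hom_X n [:0, 0, 0, 1:] [:0, r:] [:s:]) + smult b (G2_hom_Y n [:0, 1:] [:r:] [:s:])
      + smult c ([:0, 1:] ^ (3*n))) \<tau>"
    by (simp add: poly_G2_hom_X poly_G2_hom_Y xy algebra_simps eval_nat_numeral)
qed

text \<open>The form of the first coordinate presupposes b = 0: a term b y would be of order
  \<tau>^(-3), and the scaling of x by \<tau>^2 would not clear it.\<close>

lemma G2_hom_commute_weighted_Y:
  fixes a :: "'a::field_char_0"
  assumes "\<And>x y. G2_hom_Y n 1 (a*x + c) (d*x + e*y + g) = d * G2_hom_X n 1 x y + e * G2_hom_Y n 1 x y + g"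
  shows "G2_hom_Y n [:0, 1:] [:a*r, 0, c:] [:e*s, d*r, 0, g:]
    = smult d (G2_hom_X n [:0, 0, 0, 1:] [:0, r:] [:s:]) + smult e (G2_hom_Y n [:0, 1:] [:r:] [:s:])
      + smult g ([:0, 1:] ^ (3*n))"
proof (rule poly_eqI_nonzero)
  fix \<tau> :: 'a assume \<tau>: "\<tau> \<noteq> 0"
  define x y where "x = r / \<tau>^2" "y = s / \<tau>^3"
  have xy: "r = \<tau>^2 * x" "s = \<tau>^3 * y" using \<tau> by (simp_all add: x_y_def)
  have "G2_hom_Y n (\<tau> * 1) (\<tau>^2 * (a*x + c)) (\<tau>^3 * (d*x + e*y + g))
    = d * G2_hom_X n (\<tau>^3 * 1) (\<tau>^3 * x) (\<tau>^3 * y) + e * G2_hom_Y n (\<tau> * 1) (\<tau>^2 * x) (\<tau>^3 * y) + g * \<tau>^(3*n)"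
    unfolding G2_hom_X_scale G2_hom_Y_scale assms by (simp add: algebra_simps flip: power_mult)
  then show "poly (G2_hom_Y n [:0, 1:] [:a*r, 0, c:] [:e*s, d*r, 0, g:]) \<tau>
    = poly (smult d (G2_hom_X n [:0, 0, 0, 1:] [:0, r:] [:s:]) + smult e (G2_hom_Y n [:0, 1:] [:r:] [:s:])
      + smult g ([:0, 1:] ^ (3*n))) \<tau>"
    by (simp add: poly_G2_hom_X poly_G2_hom_Y xy algebra_simps eval_nat_numeral)
qed

text \<open>With b = 0 the equation of the first component involves only the X family, so the usual
  grading applies to it.\<close>

lemma G2_hom_X_commute_poly:
  fixes a :: "'a::field_char_0"
  assumes "\<And>x y. G2_hom_X n 1 (a*x + c) (d*x + e*y + g) = a * G2_hom_X n 1 x y + c"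
  shows "G2_hom_X n [:0, 1:] (smult a p + [:0, c:]) (smult d p + smult e q + [:0, g:])
    = smult a (G2_hom_X n [:0, 1:] p q) + smult c ([:0, 1:] ^ n)"
proof (rule poly_eqI_nonzero)
  fix \<tau> :: 'a assume \<tau>: "\<tau> \<noteq> 0"
  define x y where "x = poly p \<tau> / \<tau>" "y = poly q \<tau> / \<tau>"
  have xy: "poly p \<tau> = \<tau> * x" "poly q \<tau> = \<tau> * y" using \<tau> by (simp_all add: x_y_def)
  have "G2_hom_X n (\<tau> * 1) (\<tau> * (a*x + c)) (\<tau> * (d*x + e*y + g))
    = a * G2_hom_X n (\<tau> * 1) (\<tau> * x) (\<tau> * y) + c * \<tau>^n"
    unfolding G2_hom_X_scale assms by (simp add: algebra_simps)
  then show "poly (G2_hom_X n [:0, 1:] (smult a p + [:0, c:]) (smult d p + smult e q + [:0, g:])) \<tau>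
    = poly (smult a (G2_hom_X n [:0, 1:] p q) + smult c ([:0, 1:] ^ n)) \<tau>"
    by (simp add: poly_G2_hom_X xy algebra_simps)
qed

lemma G2_affine_commute:
  fixes a b c d e g :: "'a::{alg_closed_field, field_char_0}" and m :: nat
  defines "n \<equiv> Suc (Suc m)"
  assumes det: "a * e - b * d \<noteq> 0"
    and X: "\<And>x y. G2_hom_X n 1 (a*x + b*y + c) (d*x + e*y + g) = a * G2_hom_X n 1 x y + b * G2_hom_Y n 1 x y + c"
    and Y: "\<And>x y. G2_hom_Y n 1 (a*x + b*y + c) (d*x + e*y + g) = d * G2_hom_X n 1 x y + e * G2_hom_Y n 1 x y + g"
  shows "a = 1" "b = 0" "c = 0" "d = 0" "e = 1" "g = 0"
proof -
  have n0: "of_nat n \<noteq> (0::'a)" by (simp add: n_def del: of_nat_Suc)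
  have GX: "coeff (G2_hom_X n [:0, 1:] p q) 0 = coeff p 0 ^ n"
     "coeff (G2_hom_X n [:0, 1:] p q) (Suc 0) =
        of_nat n * (coeff p 0 ^ Suc m * coeff p (Suc 0) - coeff p 0 ^ m * coeff q 0)
        - (if m = 0 then 2 * coeff p 0 else 0)" for p q :: "'a poly"
    unfolding n_def using G2_hom_X_coeff[of "[:0, 1:]" m p q] by simp_all
  have GX3: "coeff (G2_hom_X n [:0, 0, 0, 1:] p q) 0 = coeff p 0 ^ n"
     "coeff (G2_hom_X n [:0, 0, 0, 1:] p q) (Suc 0) =
        of_nat n * (coeff p 0 ^ Suc m * coeff p (Suc 0))" for p q :: "'a poly"
    unfolding n_def using G2_hom_X_coeff[of "[:0, 0, 0, 1:]" m p q] by simp_all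
  have GY: "coeff (G2_hom_Y n [:0, 1:] p q) 0 = dickson n (coeff q 0) (coeff p 0 ^ 3)" for p q :: "'a poly"
    unfolding n_def using G2_hom_Y_coeff_0[of "[:0, 1:]" "Suc m" p q] by simp
  have Tn: "coeff ([:0, 1:] ^ n) 0 = (0::'a)" "coeff ([:0, 1:] ^ n) (Suc 0) = (0::'a)"
    "coeff ([:0, 1:] ^ (3*n)) 0 = (0::'a)" "coeff ([:0, 1:] ^ (3*n)) (Suc 0) = (0::'a)"
    unfolding n_def by (rule coeff_power_less; simp)+
  have zn: "(0::'a) ^ n = 0" by (simp add: n_def)
  \<comment> \<open>In the weighted grading y dominates x, so b y is the leading part of the first
    coordinate.\<close>
  have L1: "(b*s) ^ n = b * dickson n s (r^3)" for r s
    using arg_cong[OF G2_hom_commute_weighted_X[OF X, of s r], of "\<lambda>p. coeff p 0"]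
    by (simp add: GX3 GY Tn zn)
  show b: "b = 0"
  proof (rule ccontr)
    assume b: "b \<noteq> 0"
    have "b ^ n = b" using L1[of 1 0] by (simp add: n_def)
    moreover have "(b * 2) ^ n = b * 2" using L1[of 2 1] by simp
    ultimately have "(2::'a) ^ n = 2" using b by (simp add: power_mult_distrib)
    then show False using two_power_Suc_Suc_neq unfolding n_def by blast
  qed
  note PX = G2_hom_X_commute_poly[of n a c d e g, OF X[unfolded b, simplified]]
    and PY = G2_hom_commute_weighted_Y[of n a c d e g, OF Y[unfolded b, simplified]]
  from det b have ae: "a \<noteq> 0" "e \<noteq> 0" by auto
  have an: "a ^ n = a"
    using arg_cong[OF PX[of 1 0], of "\<lambda>p. coeff p 0"] by (simp add: GX Tn)
  then have am: "a ^ Suc m = 1" using ae by (simp add: n_def)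
  \<comment> \<open>Order t along x = 1 with y constant; the exceptional term at n = 2 is - 2 a on
    both sides and cancels.\<close>
  have X1: "a ^ Suc m * c - a^m * (d + e*y) = - (a * y)" for y
  proof -
    have "of_nat n * (a ^ Suc m * c - a^m * (d + e*y)) = of_nat n * (- (a * y))"
      using arg_cong[OF PX[of "1" "[:y:]"], of "\<lambda>p. coeff p (Suc 0)"]
      by (simp add: GX Tn algebra_simps split: if_splits)
    then show ?thesis using n0 by (metis mult_left_cancel)
  qed
  have d: "d = a * c" using X1[of 0] ae by simp
  from X1[of 1] have ame: "a^m * e = a" unfolding d by (simp add: algebra_simps)
  have ea: "e = a^2" using ame am by (metis mult.assoc mult.left_neutral power2_eq_square power_Suc)
  have L2: "dickson n (e*s) (a^3 * q) = e * dickson n s q" for s q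
  proof -
    \<comment> \<open>The weighted leading form sees x only through its cube; over an algebraically
      closed field every \<open>q\<close> is a cube.\<close>
    obtain r where "r ^ 3 = q" using nth_root_exists[of 3 q] by auto
    then show ?thesis
      using arg_cong[OF PY[of r s], of "\<lambda>p. coeff p 0"] 
      by (simp add: GX3 GY Tn zn power_mult_distrib)
  qed
  \<comment> \<open>An identity in the second Dickson argument; its linear coefficient gives e^(n-2)
    a^3 = e, hence a = 1 by e = a^2 and a^(n-1) = 1.\<close>
  have "dickson n [:e:] [:0, a^3:] = smult e (dickson n 1 [:0, 1:])"
    by (rule poly_ext) (use L2[of 1] in \<open>simp add: poly_dickson mult.commute\<close>)
  from arg_cong[OF this, of "\<lambda>p. coeff p (Suc 0)"]
  have "of_nat n * (e ^ m * a^3) = of_nat n * e"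
    using dickson_coeff[of "[:0, a^3:]" m "[:e:]"] dickson_coeff[of "[:0, 1::'a:]" m 1]
    by (simp add: n_def algebra_simps del: of_nat_Suc dickson.simps)
  then have "e ^ m * a^3 = e" using n0 by (metis mult_left_cancel)
  then have "(a ^ Suc m)^2 * a = a^2" 
    unfolding ea by (simp add: power2_eq_square eval_nat_numeral power_mult_distrib mult_ac)
  then show a: "a = 1" unfolding am using ae by (simp add: power2_eq_square)
  then show e: "e = 1" using ea by simp
  have G1: "coeff (G2_hom_Y n [:0, 1:] [:1, 0, c1:] [:2, c2, 0, g':]) (Suc 0)
     = of_nat n^2 * (c2 + 6) - 6 * of_nat n" for c1 c2 g' :: 'a
    unfolding n_def using G2_hom_Y_coeff_1[of "Suc m" c1 c2 g'] by simp
  \<comment> \<open>The weighted curve starts at r = 1, s = 2. The X family contributes nothing at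
    first order, so both sides are given by \<open>G1\<close>, with deviations \<open>d\<close> and
    0.\<close>
  have "of_nat n ^2 * (d + 6) = of_nat n ^2 * (6::'a)"
    using arg_cong[OF PY[of 1 2], of "\<lambda>p. coeff p (Suc 0)"] G1[of c d g] G1[of 0 0 0] a e
    by (simp add: GX3 Tn)
  then have "d + 6 = 6" using n0 by (metis mult_left_cancel power_not_zero)
  then show d0: "d = 0" by simp
  then show c: "c = 0" using d a by simp
  \<comment> \<open>Only the translation \<open>g\<close> remains; it shifts y = 0 to y = g t and is
    detected at order t^2.\<close>
  have "G2_hom_X n [:0, 1:] 1 [:0, g:] = G2_hom_X n [:0, 1:] 1 0"
    using PX[of 1 0] a c d0 by (simp add: one_pCons)
  then have "of_nat n * g = 0" using G2_hom_X_coeff_2[of m g] by (simp add: n_def del: of_nat_Suc)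
  then show "g = 0" using n0 by simp
qed

section \<open>Affine maps commuting with the folding maps of A_2\<close>

lemma A2_hom_commute_poly:
  fixes a :: "'a::field_char_0"
  assumes "\<And>z w. A2_hom n 1 (a*z + b*w + c) (d*z + e*w + g) = a * A2_hom n 1 z w + b * A2_hom n 1 w z + c"
  shows "A2_hom n [:0, 1:] (smult a p + smult b q + [:0, c:]) (smult d p + smult e q + [:0, g:])
    = smult a (A2_hom n [:0, 1:] p q) + smult b (A2_hom n [:0, 1:] q p) + smult c ([:0, 1:] ^ n)"
proof (rule poly_eqI_nonzero)
  fix \<tau> :: 'a assume \<tau>: "\<tau> \<noteq> 0"
  define x y where "x = poly p \<tau> / \<tau>" "y = poly q \<tau> / \<tau>"
  have xy: "poly p \<tau> = \<tau> * x" "poly q \<tau> = \<tau> * y" using \<tau> by (simp_all add: x_y_def)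
  have "A2_hom n (\<tau> * 1) (\<tau> * (a*x + b*y + c)) (\<tau> * (d*x + e*y + g))
    = a * A2_hom n (\<tau> * 1) (\<tau> * x) (\<tau> * y) + b * A2_hom n (\<tau> * 1) (\<tau> * y) (\<tau> * x) + c * \<tau>^n"
    unfolding A2_hom_scale assms by (simp add: algebra_simps)
  then show "poly (A2_hom n [:0, 1:] (smult a p + smult b q + [:0, c:]) (smult d p + smult e q + [:0, g:])) \<tau>
    = poly (smult a (A2_hom n [:0, 1:] p q) + smult b (A2_hom n [:0, 1:] q p) + smult c ([:0, 1:] ^ n)) \<tau>"
    by (simp add: poly_A2_hom xy algebra_simps)
qed

text \<open>Only the equation of one component enters, so the result applies to either row of the
  affine map, after exchanging \<open>z\<close> and \<open>w\<close> for the second.\<close>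

lemma A2_affine_commute_row:
  fixes a b c d e g :: "'a::field_char_0" and m :: nat
  defines "n \<equiv> Suc (Suc m)"
  assumes X: "\<And>z w. A2_hom n 1 (a*z + b*w + c) (d*z + e*w + g) = a * A2_hom n 1 z w + b * A2_hom n 1 w z + c"
    and a: "a \<noteq> 0"
  shows "b = 0" "a ^ Suc m = 1" "d = 0 \<Longrightarrow> c = 0" "d = 0 \<Longrightarrow> e = a^2"
proof -
  note PX = A2_hom_commute_poly[OF X]
  have n0: "of_nat n \<noteq> (0::'a)" by (simp add: n_def del: of_nat_Suc)
  have A: "coeff (A2_hom n [:0, 1:] p q) 0 = coeff p 0 ^ n"
     "coeff (A2_hom n [:0, 1:] p q) (Suc 0) =
        of_nat n * (coeff p 0 ^ Suc m * coeff p (Suc 0) - coeff p 0 ^ m * coeff q 0)" for p q :: "'a poly"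
    unfolding n_def using A2_hom_coeff[of "[:0, 1:]" m p q] by simp_all
  have Tn: "coeff ([:0, 1:] ^ n) 0 = (0::'a)" "coeff ([:0, 1:] ^ n) (Suc 0) = (0::'a)"
    unfolding n_def by (rule coeff_power_less; simp)+
  have zn: "(0::'a) ^ n = 0" by (simp add: n_def)
  have L1: "(a*x + b*y) ^ n = a * x^n + b * y^n" for x y
    using arg_cong[OF PX[of "[:x:]" "[:y:]"], of "\<lambda>p. coeff p 0"] by (simp add: A Tn mult.commute)
  \<comment> \<open>\<open>L1\<close> at x = 1 as a polynomial identity in y: the linear coefficient
    n a^(n-1) b has to vanish.\<close>
  have "[:a, b:] ^ n = [:a:] + smult b ([:0, 1:] ^ n)"
    by (rule poly_ext) (use L1[of 1] in \<open>simp add: mult.commute\<close>)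
  then have "coeff ([:a, b:] ^ n) (Suc 0) = 0" by (simp add: Tn)
  then show b: "b = 0"
    using coeff_power_1[of "[:a, b:]" "Suc m"] n0 a by (simp add: n_def del: of_nat_Suc power_Suc)
  have "a ^ n = a" using L1[of 1 0] by (simp add: zn)
  then show am: "a ^ Suc m = 1" using a by (simp add: n_def)
  have X1: "a ^ Suc m * c - a^m * (d + e*y) = - (a * y)" for y
  proof -
    have "of_nat n * (a ^ Suc m * c - a^m * (d + e*y)) = of_nat n * (- (a * y))"
      using arg_cong[OF PX[of "1" "[:y:]"], of "\<lambda>p. coeff p (Suc 0)"] b by (simp add: A Tn)
    then show ?thesis using n0 by (metis mult_left_cancel)
  qed
  show "c = 0" "e = a^2" if "d = 0"
  proof -
    show c: "c = 0" using X1[of 0] that a by simp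
    have "a^m * e = a" using X1[of 1] c that by simp
    then show "e = a^2" using am by (metis mult.assoc mult.left_neutral power2_eq_square power_Suc)
  qed
qed



lemma A2_affine_commute_diag:
  fixes a b c d e g :: "'a::field_char_0" and m :: nat
  defines "n \<equiv> Suc (Suc m)"
  assumes det: "a * e - b * d \<noteq> 0"
    and X: "\<And>z w. A2_hom n 1 (a*z + b*w + c) (d*z + e*w + g) = a * A2_hom n 1 z w + b * A2_hom n 1 w z + c"
    and Y: "\<And>z w. A2_hom n 1 (d*z + e*w + g) (a*z + b*w + c) = d * A2_hom n 1 z w + e * A2_hom n 1 w z + g"
    and a: "a \<noteq> 0"
  shows "b = 0" "c = 0" "d = 0" "e = a^2" "g = 0" "a ^ Suc m = 1" "a ^ 3 = 1"
proof -
  \<comment> \<open>Exchanging \<open>z\<close> and \<open>w\<close> brings the second equation into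
    the form of the first, with leading entry \<open>e\<close>.\<close>
  have Y': "A2_hom n 1 (e*z + d*w + g) (b*z + a*w + c) = e * A2_hom n 1 z w + d * A2_hom n 1 w z + g" for z w
    using Y[of w z] by (simp add: add.commute)
  note row1 = A2_affine_commute_row[OF X[unfolded n_def] a]
  show b: "b = 0" by (rule row1)
  from det b have e: "e \<noteq> 0" by auto
  note row2 = A2_affine_commute_row[OF Y'[unfolded n_def] e]
  show d: "d = 0" by (rule row2)
  show "c = 0" and ea: "e = a^2" by (rule row1 d)+
  show "g = 0" by (rule row2 b)+
  show "a ^ Suc m = 1" by (rule row1)
  \<comment> \<open>Together with e = a^2 this gives a = a^4.\<close>
  have "a = e^2" by (rule row2 b)+
  then have "a * a ^ 3 = a * 1" unfolding ea by (simp add: eval_nat_numeral)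
  then show "a ^ 3 = 1" using a by (metis mult_left_cancel)
qed

text \<open>The map commutes with the exchange of coordinates, so the rows of the affine map may be
  interchanged; this reduces a = 0 to the case of a nonzero leading entry.\<close>

lemma A2_affine_commute:
  fixes a b c d e g :: "'a::field_char_0" and m :: nat
  defines "n \<equiv> Suc (Suc m)"
  assumes det: "a * e - b * d \<noteq> 0"
    and X: "\<And>z w. A2_hom n 1 (a*z + b*w + c) (d*z + e*w + g) = a * A2_hom n 1 z w + b * A2_hom n 1 w z + c"
    and Y: "\<And>z w. A2_hom n 1 (d*z + e*w + g) (a*z + b*w + c) = d * A2_hom n 1 z w + e * A2_hom n 1 w z + g"
  shows "c = 0 \<and> g = 0 \<and> (b = 0 \<and> d = 0 \<and> e = a^2 \<and> a ^ Suc m = 1 \<and> a ^ 3 = 1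
    \<or> a = 0 \<and> e = 0 \<and> b = d^2 \<and> d ^ Suc m = 1 \<and> d ^ 3 = 1)"
proof (cases "a = 0")
  case False
  then show ?thesis using A2_affine_commute_diag[OF det X[unfolded n_def] Y[unfolded n_def] False] by simp
next
  case True
  then have d: "d \<noteq> 0" and det': "d * b - e * a \<noteq> 0" using det by (auto simp: algebra_simps)
  show ?thesis using A2_affine_commute_diag[OF det' Y[unfolded n_def] X[unfolded n_def] d] by simp
qed

text \<open>Give \<open>z\<close> degree 1 and \<open>w\<close> degree 2 modulo 3: every term of the
  recursion for A_n then has degree n modulo 3.\<close>

lemma A2_hom_omega:
  fixes a :: "'a::comm_ring_1"
  assumes "a ^ 3 = 1"
  shows "A2_hom n 1 (a*z) (a^2*w) = a^n * A2_hom n 1 z w"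
proof -
  have a3: "a * (a * a) = 1" "a * (a * (a * u)) = u" for u
    using assms by (simp_all add: eval_nat_numeral flip: mult.assoc)
  show ?thesis
    by (induction n rule: nat_induct_012_3)
       (simp_all add: algebra_simps power2_eq_square a3)
qed

section \<open>The automorphism groups\<close>

lemma is_iso_integer_mod_group_2:
  assumes "group G" "carrier G = {\<one>\<^bsub>G\<^esub>, s}" "s \<noteq> \<one>\<^bsub>G\<^esub>"
  shows "G \<cong> integer_mod_group 2"
proof -
  interpret group G by fact
  have s: "s \<in> carrier G" using assms(2) by simp
  then have "s \<otimes>\<^bsub>G\<^esub> s \<in> {\<one>\<^bsub>G\<^esub>, s}" using assms(2) m_closed by blast
  moreover have "s \<otimes>\<^bsub>G\<^esub> s \<noteq> s" using s assms(3) by (metis r_cancel_one)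
  ultimately have ss: "s \<otimes>\<^bsub>G\<^esub> s = \<one>\<^bsub>G\<^esub>" by simp
  define h where "h = (\<lambda>x. if x = \<one>\<^bsub>G\<^esub> then 0 else 1::int)"
  have "h \<in> iso G (integer_mod_group 2)"
  proof (rule isoI)
    show "h \<in> hom G (integer_mod_group 2)"
      using assms(2,3) s ss by (intro homI) (auto simp: h_def carrier_integer_mod_group)
    have "{0..<2} = {0, 1::int}" by auto
    then show "bij_betw h (carrier G) (carrier (integer_mod_group 2))"
      using assms(2,3) by (auto simp: bij_betw_def h_def carrier_integer_mod_group)
  qed
  then show ?thesis by (rule is_isoI)
qed

text \<open>A faithful action on n points embeds the group into the symmetric group, and the
  cardinality n! makes the embedding onto. \<open>p\<close> numbers the points of
  \<open>S\<close>.\<close>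

lemma is_iso_sym_group_if_faithful:
  fixes G :: "('a \<Rightarrow> 'a) monoid"
  assumes mult: "mult G = (\<circ>)"
    and p: "bij_betw p {1..n} S"
    and act: "\<And>\<phi>. \<phi> \<in> carrier G \<Longrightarrow> \<phi> ` S \<subseteq> S"
    and inj: "\<And>\<phi>. \<phi> \<in> carrier G \<Longrightarrow> inj_on \<phi> S"
    and faithful: "\<And>\<phi> \<psi>. \<phi> \<in> carrier G \<Longrightarrow> \<psi> \<in> carrier G \<Longrightarrow> (\<And>x. x \<in> S \<Longrightarrow> \<phi> x = \<psi> x) \<Longrightarrow> \<phi> = \<psi>"
    and card: "card (carrier G) = fact n"
  shows "G \<cong> sym_group n"
proof -
  define q where "q = inv_into {1..n} p"
  \<comment> \<open>Numbers outside \<open>{1..n}\<close> are fixed, as \<open>permutes\<close>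
    demands.\<close>
  define F where "F = (\<lambda>\<phi> k. if k \<in> {1..n} then q (\<phi> (p k)) else k)"
  have pS: "p k \<in> S" if "k \<in> {1..n}" for k using p that by (auto simp: bij_betw_def)
  have qS: "q x \<in> {1..n}" "p (q x) = x" if "x \<in> S" for x
    using p that unfolding q_def by (auto simp: bij_betw_def inv_into_into f_inv_into_f)
  have qp: "q (p k) = k" if "k \<in> {1..n}" for k
    using p that unfolding q_def by (simp add: bij_betw_def)
  have act': "\<phi> x \<in> S" if "\<phi> \<in> carrier G" "x \<in> S" for \<phi> x
    using act that by blast
  have F: "F \<phi> permutes {1..n}" if \<phi>: "\<phi> \<in> carrier G" for \<phi>
  proof (rule bij_imp_permutes)
    have "inj_on (F \<phi>) {1..n}"
    proof (rule inj_onI)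
      fix j k assume jk: "j \<in> {1..n}" "k \<in> {1..n}" "F \<phi> j = F \<phi> k"
      then have "p (q (\<phi> (p j))) = p (q (\<phi> (p k)))" by (simp add: F_def)
      then have "\<phi> (p j) = \<phi> (p k)" using jk(1,2) \<phi> by (simp only: qS act' pS)
      then have "p j = p k" using inj[OF \<phi>] jk(1,2) pS by (auto dest: inj_onD)
      then show "j = k" using qp jk(1,2) by metis
    qed
    moreover have "F \<phi> ` {1..n} \<subseteq> {1..n}" using qS(1) act'[OF \<phi> pS] by (auto simp: F_def)
    ultimately show "bij_betw (F \<phi>) {1..n} {1..n}"
      by (simp add: bij_betw_def endo_inj_surj)
  qed (auto simp: F_def)
  have "F \<in> iso G (sym_group n)"
  proof (rule isoI)
    show "F \<in> hom G (sym_group n)"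
    proof (rule homI)
      fix \<phi> \<psi> assume *: "\<phi> \<in> carrier G" "\<psi> \<in> carrier G"
      have "F (\<phi> \<circ> \<psi>) k = (F \<phi> \<circ> F \<psi>) k" for k
      proof (cases "k \<in> {1..n}")
        case True
        have "F (\<phi> \<circ> \<psi>) k = q (\<phi> (\<psi> (p k)))" using True by (simp add: F_def)
        also have "\<dots> = F \<phi> (q (\<psi> (p k)))"
          using qS[OF act'[OF *(2) pS[OF True]]] by (simp add: F_def)
        also have "q (\<psi> (p k)) = F \<psi> k" using True by (simp add: F_def)
        finally show ?thesis unfolding comp_apply[of "F \<phi>"] .
      qed (auto simp: F_def)
      then show "F (\<phi> \<otimes>\<^bsub>G\<^esub> \<psi>) = F \<phi> \<otimes>\<^bsub>sym_group n\<^esub> F \<psi>"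
        by (auto simp: mult sym_group_mult)
    qed (use F in \<open>simp add: sym_group_carrier\<close>)
    have "inj_on F (carrier G)"
    proof (rule inj_onI)
      fix \<phi> \<psi> assume *: "\<phi> \<in> carrier G" "\<psi> \<in> carrier G" "F \<phi> = F \<psi>"
      show "\<phi> = \<psi>"
      proof (rule faithful[OF *(1,2)])
        fix x assume x: "x \<in> S"
        have "F \<phi> (q x) = F \<psi> (q x)" using *(3) by simp
        then have "q (\<phi> x) = q (\<psi> x)" using qS[OF x] by (simp add: F_def)
        then show "\<phi> x = \<psi> x" using qS(2)[OF act'[OF *(1) x]] qS(2)[OF act'[OF *(2) x]] by metis
      qed
    qed
    moreover have "F ` carrier G = carrier (sym_group n)"
    proof (rule card_subset_eq)
      show "F ` carrier G \<subseteq> carrier (sym_group n)" using F by (auto simp: sym_group_carrier)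
      show "finite (carrier (sym_group n))" by (simp add: sym_group_def finite_permutations)
      show "card (F ` carrier G) = card (carrier (sym_group n))"
        by (simp add: card_image[OF \<open>inj_on F (carrier G)\<close>] card sym_group_def card_permutations)
    qed
    ultimately show "bij_betw F (carrier G) (carrier (sym_group n))" by (simp add: bij_betw_def)
  qed
  then show ?thesis by (rule is_isoI)
qed

section \<open>Invariance under affine conjugation\<close>

lemma Aut_carrier_iff: "\<phi> \<in> carrier (Aut f) \<longleftrightarrow> \<phi> \<in> affine_auts \<and> f \<circ> \<phi> = \<phi> \<circ> f"
  by (auto simp: Aut_def Aut_iff_commute)

lemma Aut_mult: "mult (Aut f) = (\<circ>)" and Aut_one: "one (Aut f) = id"
  by (simp_all add: Aut_def)

text \<open>Conjugation by \<open>P\<close> carries one group to the other. This allows the passage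
  to complex coordinates for A_2.\<close>

lemma Aut_conjugate_iso:
  assumes P: "P \<in> affine_auts" and conj: "P \<circ> f = f' \<circ> P"
  shows "Aut f \<cong> Aut f'"
proof -
  obtain Q where Q: "Q \<in> affine_auts" "Q \<circ> P = id" "P \<circ> Q = id"
    using affine_auts_inverse[OF P] .
  have QP [simp]: "Q (P x) = x" "P (Q x) = x" for x using Q(2,3) by (metis comp_apply id_apply)+
  have Pf: "P (f x) = f' (P x)" for x using conj by (metis comp_apply)
  have Qf: "Q (f' x) = f (Q x)" for x using Pf[of "Q x"] by (metis QP)
  define h where "h = (\<lambda>\<phi>. P \<circ> \<phi> \<circ> Q)"
  define h' where "h' = (\<lambda>\<phi>. Q \<circ> \<phi> \<circ> P)"
  have "h \<phi> \<in> carrier (Aut f')" if "\<phi> \<in> carrier (Aut f)" for \<phi>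
  proof -
    have "f (\<phi> x) = \<phi> (f x)" for x using that by (metis Aut_carrier_iff comp_apply)
    then have "f' \<circ> h \<phi> = h \<phi> \<circ> f'" by (simp only: fun_eq_iff h_def comp_apply Qf Pf[symmetric] simp_thms)
    then show ?thesis using that P Q(1) by (simp add: Aut_carrier_iff h_def affine_auts_comp)
  qed
  moreover have "h' \<phi> \<in> carrier (Aut f)" if "\<phi> \<in> carrier (Aut f')" for \<phi>
  proof -
    have "f' (\<phi> x) = \<phi> (f' x)" for x using that by (metis Aut_carrier_iff comp_apply)
    then have "f \<circ> h' \<phi> = h' \<phi> \<circ> f" by (simp only: fun_eq_iff h'_def comp_apply Pf Qf[symmetric] simp_thms)
    then show ?thesis using that P Q(1) by (simp add: Aut_carrier_iff h'_def affine_auts_comp)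
  qed
  moreover have "h' (h \<phi>) = \<phi>" "h (h' \<phi>) = \<phi>" for \<phi>
    by (auto simp: h_def h'_def)
  ultimately have "bij_betw h (carrier (Aut f)) (carrier (Aut f'))"
    by (intro bij_betw_byWitness[where f' = h']) auto
  moreover have "h \<in> hom (Aut f) (Aut f')"
    using \<open>\<And>\<phi>. \<phi> \<in> carrier (Aut f) \<Longrightarrow> h \<phi> \<in> carrier (Aut f')\<close>
    by (intro homI) (auto simp: Aut_mult h_def)
  ultimately show ?thesis by (intro is_isoI isoI)
qed

section \<open>The groups for B_2 and G_2\<close>

text \<open>With \<open>B2_hom_Y_uminus\<close> this shows that (x, y) -> (-x, y) commutes with the
  folding maps of odd index.\<close>

lemma B2_hom_X_uminus: "B2_hom_X n t (- x) y = (- 1) ^ n * B2_hom_X n t x y"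
  by (induction n t x y rule: B2_hom_X.induct) (simp_all add: algebra_simps power3_eq_cube)

lemma B2_hom_Y_uminus: "B2_hom_Y n t (- x) y = B2_hom_Y n t x y"
  by (induction n t x y rule: B2_hom_Y.induct) simp_all

lemma fold_B2_eq: "fold_B2 n (x, y) = (B2_hom_X n 1 x y, B2_hom_Y n 1 x y)"
  by (simp add: fold_B2_def poly_map2_def eval2_B2_X eval2_B2_Y)

lemma fold_G2_eq: "fold_G2 n (x, y) = (G2_hom_X n 1 x y, G2_hom_Y n 1 x y)"
  by (simp add: fold_G2_def poly_map2_def eval2_G2_X eval2_G2_Y)


lemma affine_autsE:
  assumes "\<phi> \<in> affine_auts"
  obtains a b c d e g where "a * e - b * d \<noteq> 0" "\<phi> = (\<lambda>(x, y). (a * x + b * y + c, d * x + e * y + g))"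
  using assms unfolding affine_auts_def by blast

lemma affine_autsI:
  "a * e - b * d \<noteq> 0 \<Longrightarrow> (\<lambda>(x, y). (a * x + b * y + c, d * x + e * y + g)) \<in> affine_auts"
  unfolding affine_auts_def by blast

lemma trivial_Aut_G2:
  "trivial_group (Aut (fold_G2 (Suc (Suc m)) :: 'a \<times> 'a \<Rightarrow> 'a::{alg_closed_field, field_char_0} \<times> 'a))"
proof -
  interpret group "Aut (fold_G2 (Suc (Suc m)) :: 'a \<times> 'a \<Rightarrow> 'a \<times> 'a)" by (rule group_Aut)
  have "\<phi> = id" if "\<phi> \<in> carrier (Aut (fold_G2 (Suc (Suc m)) :: 'a \<times> 'a \<Rightarrow> 'a \<times> 'a))" for \<phi>
  proof -
    from that have aff: "\<phi> \<in> affine_auts"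
      and comm: "fold_G2 (Suc (Suc m)) (\<phi> (x, y)) = \<phi> (fold_G2 (Suc (Suc m)) (x, y))" for x y
      unfolding Aut_carrier_iff by (auto simp: fun_eq_iff)
    from aff obtain a b c d e g where det: "a * e - b * d \<noteq> 0"
      and \<phi>: "\<phi> = (\<lambda>(x, y). (a * x + b * y + c, d * x + e * y + g))"
      by (rule affine_autsE)
    have "G2_hom_X (Suc (Suc m)) 1 (a*x + b*y + c) (d*x + e*y + g)
        = a * G2_hom_X (Suc (Suc m)) 1 x y + b * G2_hom_Y (Suc (Suc m)) 1 x y + c"
      "G2_hom_Y (Suc (Suc m)) 1 (a*x + b*y + c) (d*x + e*y + g)
        = d * G2_hom_X (Suc (Suc m)) 1 x y + e * G2_hom_Y (Suc (Suc m)) 1 x y + g" for x y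
      using comm[of x y] unfolding \<phi> by (simp_all only: fold_G2_eq prod.case prod.inject)
    from G2_affine_commute[OF det this] show "\<phi> = id"
      by (simp add: \<phi> fun_eq_iff)
  qed
  then show ?thesis by (auto simp: trivial_group_subset Aut_one)
qed

text \<open>Both conditions on \<open>a\<close> are kept as equations, so that the two parities of n
  can be read off separately.\<close>

lemma carrier_Aut_B2:
  "carrier (Aut (fold_B2 (Suc (Suc m)))) =
    (\<lambda>a. \<lambda>(x, y). (a * x, y)) ` {a :: 'a::field_char_0. a ^ Suc m = 1 \<and> a^2 = 1}"
proof (intro equalityI subsetI)
  fix \<phi> :: "'a \<times> 'a \<Rightarrow> 'a \<times> 'a"
  assume "\<phi> \<in> carrier (Aut (fold_B2 (Suc (Suc m))))"
  then have aff: "\<phi> \<in> affine_auts"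
    and comm: "fold_B2 (Suc (Suc m)) (\<phi> (x, y)) = \<phi> (fold_B2 (Suc (Suc m)) (x, y))" for x y
    unfolding Aut_carrier_iff by (auto simp: fun_eq_iff)
  from aff obtain a b c d e g where det: "a * e - b * d \<noteq> 0"
    and \<phi>: "\<phi> = (\<lambda>(x, y). (a * x + b * y + c, d * x + e * y + g))"
    by (rule affine_autsE)
  have "B2_hom_X (Suc (Suc m)) 1 (a*x + b*y + c) (d*x + e*y + g)
      = a * B2_hom_X (Suc (Suc m)) 1 x y + b * B2_hom_Y (Suc (Suc m)) 1 x y + c"
    "B2_hom_Y (Suc (Suc m)) 1 (a*x + b*y + c) (d*x + e*y + g)
      = d * B2_hom_X (Suc (Suc m)) 1 x y + e * B2_hom_Y (Suc (Suc m)) 1 x y + g" for x y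
    using comm[of x y] unfolding \<phi> by (simp_all only: fold_B2_eq prod.case prod.inject)
  note * = B2_affine_commute[OF det this]
  have "\<phi> = (\<lambda>(x, y). (a * x, y))" by (simp add: \<phi> * fun_eq_iff)
  then show "\<phi> \<in> (\<lambda>a. \<lambda>(x, y). (a * x, y)) ` {a. a ^ Suc m = 1 \<and> a^2 = 1}" using * by blast
next
  fix \<phi> :: "'a \<times> 'a \<Rightarrow> 'a \<times> 'a"
  assume "\<phi> \<in> (\<lambda>a. \<lambda>(x, y). (a * x, y)) ` {a. a ^ Suc m = 1 \<and> a^2 = 1}"
  then obtain a where a: "a ^ Suc m = 1" "a^2 = 1" and \<phi>: "\<phi> = (\<lambda>(x, y). (a * x, y))" by blast
  have a0: "a \<noteq> 0" using a(2) by auto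
  have "\<phi> \<in> affine_auts" using affine_autsI[of a 1 0 0 0 0] a0 by (simp add: \<phi>)
  moreover have "a = 1 \<or> a = -1" using a(2) by (simp add: power2_eq_1_iff)
  then have "fold_B2 (Suc (Suc m)) (\<phi> p) = \<phi> (fold_B2 (Suc (Suc m)) p)" for p
  proof
    assume am: "a = -1"
    then have "(-1::'a) ^ Suc (Suc m) = -1" using a(1) by simp
    then show ?thesis
      by (cases p) (simp only: \<phi> am prod.case fold_B2_eq mult_minus1 B2_hom_X_uminus B2_hom_Y_uminus)
  qed (simp add: \<phi>)
  ultimately show "\<phi> \<in> carrier (Aut (fold_B2 (Suc (Suc m))))"
    by (simp add: Aut_carrier_iff fun_eq_iff)
qed

lemma Aut_B2_odd:
  assumes "odd m"
  shows "Aut (fold_B2 (Suc (Suc m)) :: 'a \<times> 'a \<Rightarrow> 'a::field_char_0 \<times> 'a) \<cong> integer_mod_group 2"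
proof (rule is_iso_integer_mod_group_2[OF group_Aut])
  have "{a :: 'a. a ^ Suc m = 1 \<and> a^2 = 1} = {1, -1}"
    using assms by (auto simp: power2_eq_1_iff)
  then show "carrier (Aut (fold_B2 (Suc (Suc m)) :: 'a \<times> 'a \<Rightarrow> 'a \<times> 'a)) =
      {\<one>\<^bsub>Aut (fold_B2 (Suc (Suc m)))\<^esub>, \<lambda>(x, y). (- x, y)}"
    unfolding carrier_Aut_B2 by (auto simp: Aut_one fun_eq_iff)
  show "(\<lambda>(x, y). (- x, y)) \<noteq> \<one>\<^bsub>Aut (fold_B2 (Suc (Suc m)) :: 'a \<times> 'a \<Rightarrow> 'a \<times> 'a)\<^esub>"
    by (auto simp: Aut_one fun_eq_iff intro!: exI[of _ 1])
qed

lemma Aut_B2_even: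
  assumes "even m"
  shows "trivial_group (Aut (fold_B2 (Suc (Suc m)) :: 'a \<times> 'a \<Rightarrow> 'a::field_char_0 \<times> 'a))"
proof -
  interpret group "Aut (fold_B2 (Suc (Suc m)) :: 'a \<times> 'a \<Rightarrow> 'a \<times> 'a)" by (rule group_Aut)
  have "{a :: 'a. a ^ Suc m = 1 \<and> a^2 = 1} \<subseteq> {1}"
    using assms by (auto simp: power2_eq_1_iff)
  then show ?thesis
    unfolding trivial_group_subset carrier_Aut_B2 by (auto simp: Aut_one fun_eq_iff)
qed

section \<open>The groups for A_2\<close>

text \<open>For a^3 = 1 the factor a^2 is the inverse of a, so this is the rotation z -> a z in
  complex coordinates.\<close>

definition A2_diag :: "'a \<Rightarrow> 'a \<times> 'a \<Rightarrow> 'a::field \<times> 'a" where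
  "A2_diag a = (\<lambda>(z, w). (a * z, a^2 * w))"

text \<open>\<open>A2_diag a\<close> followed by the exchange of the two coordinates, the analogue
  of complex conjugation.\<close>

definition A2_anti :: "'a \<Rightarrow> 'a \<times> 'a \<Rightarrow> 'a::field \<times> 'a" where
  "A2_anti a = (\<lambda>(z, w). (a^2 * w, a * z))"

definition complex_fold_A2 :: "nat \<Rightarrow> 'a \<times> 'a \<Rightarrow> 'a::field \<times> 'a" where
  "complex_fold_A2 n = (\<lambda>(z, w). (A2_hom n 1 z w, A2_hom n 1 w z))"

lemma Aut_fold_A2_iso:
  "Aut (fold_A2 n :: 'a \<times> 'a \<Rightarrow> 'a::{alg_closed_field, field_char_0} \<times> 'a) \<cong> Aut (complex_fold_A2 n :: 'a \<times> 'a \<Rightarrow> _)"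
proof -
  obtain i :: 'a where i: "i^2 = -1" using nth_root_exists[of 2 "-1 :: 'a"] by auto
  then have i0: "i \<noteq> 0" by auto
  show ?thesis
  proof (rule Aut_conjugate_iso)
    have "1 * (- i) - i * 1 = (-2) * i" by simp
    also have "\<dots> \<noteq> 0" using i0 by simp
    \<comment> \<open>The factors 1 and summands 0 give the map the general shape of
      \<open>affine_autsI\<close>.\<close>
    finally show "(\<lambda>(x, y). (1 * x + i * y + 0, 1 * x + (- i) * y + 0)) \<in> affine_auts" by (rule affine_autsI)
    show "(\<lambda>(x, y). (1 * x + i * y + 0, 1 * x + (- i) * y + 0)) \<circ> fold_A2 n =
      complex_fold_A2 n \<circ> (\<lambda>(x, y). (1 * x + i * y + 0, 1 * x + (- i) * y + 0))"
      using eval2_A2[OF i]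
      by (auto simp: fun_eq_iff fold_A2_def poly_map2_def complex_fold_A2_def)
  qed
qed

lemma carrier_Aut_A2:
  defines "U m \<equiv> {a :: 'a::field_char_0. a ^ Suc m = 1 \<and> a ^ 3 = 1}"
  shows "carrier (Aut (complex_fold_A2 (Suc (Suc m)))) = A2_diag ` U m \<union> A2_anti ` U m"
proof (intro equalityI subsetI)
  fix \<phi> :: "'a \<times> 'a \<Rightarrow> 'a \<times> 'a"
  assume "\<phi> \<in> carrier (Aut (complex_fold_A2 (Suc (Suc m))))"
  then have aff: "\<phi> \<in> affine_auts"
    and comm: "complex_fold_A2 (Suc (Suc m)) (\<phi> (x, y)) = \<phi> (complex_fold_A2 (Suc (Suc m)) (x, y))" for x y
    unfolding Aut_carrier_iff by (auto simp: fun_eq_iff)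
  from aff obtain a b c d e g where det: "a * e - b * d \<noteq> 0"
    and \<phi>: "\<phi> = (\<lambda>(x, y). (a * x + b * y + c, d * x + e * y + g))"
    by (rule affine_autsE)
  have "A2_hom (Suc (Suc m)) 1 (a*z + b*w + c) (d*z + e*w + g)
      = a * A2_hom (Suc (Suc m)) 1 z w + b * A2_hom (Suc (Suc m)) 1 w z + c"
    "A2_hom (Suc (Suc m)) 1 (d*z + e*w + g) (a*z + b*w + c)
      = d * A2_hom (Suc (Suc m)) 1 z w + e * A2_hom (Suc (Suc m)) 1 w z + g" for z w
    using comm[of z w] unfolding \<phi> by (simp_all only: complex_fold_A2_def prod.case prod.inject)
  note * = A2_affine_commute[OF det this]
  then show "\<phi> \<in> A2_diag ` U m \<union> A2_anti ` U m"
  proof (elim conjE disjE)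
    assume *: "c = 0" "g = 0" "b = 0" "d = 0" "e = a^2" "a ^ Suc m = 1" "a ^ 3 = 1"
    then have "\<phi> = A2_diag a" by (simp add: \<phi> A2_diag_def)
    then show ?thesis using * by (auto simp: U_def)
  next
    assume *: "c = 0" "g = 0" "a = 0" "e = 0" "b = d^2" "d ^ Suc m = 1" "d ^ 3 = 1"
    then have "\<phi> = A2_anti d" by (simp add: \<phi> A2_anti_def)
    then show ?thesis using * by (auto simp: U_def)
  qed
next
  fix \<phi> :: "'a \<times> 'a \<Rightarrow> 'a \<times> 'a"
  assume "\<phi> \<in> A2_diag ` U m \<union> A2_anti ` U m"
  then obtain a where a: "a ^ Suc m = 1" "a ^ 3 = 1" and \<phi>: "\<phi> = A2_diag a \<or> \<phi> = A2_anti a"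
    unfolding U_def by blast
  have a0: "a \<noteq> 0" using a(1) by auto
  have "a ^ Suc (Suc m) = a" using a(1) by (metis mult.right_neutral power_Suc)
  then have h1: "A2_hom (Suc (Suc m)) 1 (a*z) (a^2*w) = a * A2_hom (Suc (Suc m)) 1 z w" for z w
    using A2_hom_omega[OF a(2), of "Suc (Suc m)" z w] by (simp only:)
  \<comment> \<open>\<open>a^2\<close> is again a cube root of unity and its square is
    \<open>a\<close>; hence \<open>A2_hom_omega\<close> at \<open>a^2\<close> treats the second
    component.\<close>
  have a4: "(a^2)^2 = a" using a(2) by (simp add: eval_nat_numeral)
  have "(a^2) ^ Suc (Suc m) = a^2"
    using \<open>a ^ Suc (Suc m) = a\<close> by (metis power_commutes power_mult mult.commute)
  moreover have "(a^2)^3 = 1" using a(2) by (metis power_mult mult.commute power_one)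
  ultimately have h2: "A2_hom (Suc (Suc m)) 1 (a^2*w) (a*z) = a^2 * A2_hom (Suc (Suc m)) 1 w z" for z w
    using A2_hom_omega[of "a^2" "Suc (Suc m)" w z] unfolding a4 by (simp only:)
  have "A2_diag a \<in> affine_auts"
    using affine_autsI[of a "a^2" 0 0 0 0] a0 by (simp add: A2_diag_def)
  moreover have "A2_anti a \<in> affine_auts"
    using affine_autsI[of 0 0 "a^2" a 0 0] a0 by (simp add: A2_anti_def)
  ultimately have "\<phi> \<in> affine_auts" using \<phi> by auto
  moreover have "complex_fold_A2 (Suc (Suc m)) \<circ> \<phi> = \<phi> \<circ> complex_fold_A2 (Suc (Suc m))"
    using \<phi> by (auto simp: fun_eq_iff complex_fold_A2_def A2_diag_def A2_anti_def h1 h2 simp del: A2_hom.simps)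
  ultimately show "\<phi> \<in> carrier (Aut (complex_fold_A2 (Suc (Suc m))))"
    by (simp add: Aut_carrier_iff)
qed

lemma A2_diag_inj: "inj A2_diag"
proof (rule injI)
  fix a b :: 'a assume "A2_diag a = A2_diag b"
  then have "A2_diag a (1, 0) = A2_diag b (1, 0)" by simp
  then show "a = b" by (simp add: A2_diag_def)
qed

lemma A2_anti_inj: "inj A2_anti"
proof (rule injI)
  fix a b :: 'a assume "A2_anti a = A2_anti b"
  then have "A2_anti a (1, 0) = A2_anti b (1, 0)" by simp
  then show "a = b" by (simp add: A2_anti_def)
qed

lemma A2_diag_neq_anti:
  assumes "a \<noteq> 0"
  shows "A2_diag a \<noteq> A2_anti b"
proof
  assume "A2_diag a = A2_anti b"
  then have "A2_diag a (1, 0) = A2_anti b (1, 0)" by simp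
  then show False using assms by (simp add: A2_diag_def A2_anti_def)
qed

lemma A2_diag_1: "A2_diag 1 = id"
  by (auto simp: A2_diag_def)

text \<open>The exponents n - 1 and 3 are coprime, so a = 1, and only the identity and the exchange
  \<open>A2_anti 1\<close> remain.\<close>

lemma Aut_A2_mu2:
  assumes "\<not> 3 dvd Suc m"
  shows "Aut (complex_fold_A2 (Suc (Suc m)) :: 'a \<times> 'a \<Rightarrow> 'a::field_char_0 \<times> 'a) \<cong> integer_mod_group 2"
proof (rule is_iso_integer_mod_group_2[OF group_Aut])
  have "a = 1" if a: "a ^ Suc m = 1" "a ^ 3 = 1" for a :: 'a
  proof -
    have "a ^ Suc m = (a ^ 3) ^ (Suc m div 3) * a ^ (Suc m mod 3)"
      unfolding power_mult[symmetric] power_add[symmetric] mult_div_mod_eq ..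
    then have r: "a ^ (Suc m mod 3) = 1" using a by simp
    have "Suc m mod 3 = 1 \<or> Suc m mod 3 = 2"
      using assms by presburger
    then show ?thesis
    proof
      assume "Suc m mod 3 = 2"
      then have "a^2 = 1" using r by simp
      then show ?thesis using a(2) by (simp add: power2_eq_square power3_eq_cube)
    qed (use r in simp)
  qed
  then have "{a :: 'a. a ^ Suc m = 1 \<and> a ^ 3 = 1} \<subseteq> {1}" by blast
  moreover have "1 \<in> {a :: 'a. a ^ Suc m = 1 \<and> a ^ 3 = 1}" by simp
  ultimately have "{a :: 'a. a ^ Suc m = 1 \<and> a ^ 3 = 1} = {1}" by blast
  then show "carrier (Aut (complex_fold_A2 (Suc (Suc m)) :: 'a \<times> 'a \<Rightarrow> 'a \<times> 'a)) =
      {\<one>\<^bsub>Aut (complex_fold_A2 (Suc (Suc m)))\<^esub>, A2_anti 1}"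
    unfolding carrier_Aut_A2 by (auto simp: Aut_one A2_diag_1)
  show "A2_anti 1 \<noteq> \<one>\<^bsub>Aut (complex_fold_A2 (Suc (Suc m)) :: 'a \<times> 'a \<Rightarrow> 'a \<times> 'a)\<^esub>"
    using A2_diag_neq_anti[of "1::'a" 1] by (simp add: Aut_one A2_diag_1)
qed

lemma Aut_A2_S3:
  assumes "3 dvd Suc m"
  shows "Aut (complex_fold_A2 (Suc (Suc m)) :: 'a \<times> 'a \<Rightarrow> 'a::{alg_closed_field, field_char_0} \<times> 'a) \<cong> sym_group 3"
proof -
  \<comment> \<open>A primitive cube root of unity: \<omega> = 1 would give 3 = 0.\<close>
  obtain \<omega> :: 'a where "poly [:1, 1, 1:] \<omega> = 0"
    using alg_closed_imp_poly_has_root[of "[:1, 1, 1::'a:]"] by auto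
  then have w: "\<omega> * \<omega> = - 1 - \<omega>" by (simp add: algebra_simps eq_neg_iff_add_eq_0)
  have w1: "\<omega> \<noteq> 1"
  proof
    assume "\<omega> = 1"
    then have "(3::'a) = 0" using w by simp
    then show False by simp
  qed
  have w3: "\<omega> ^ 3 = 1" by (simp add: power3_eq_cube w algebra_simps)
  have w0: "\<omega> \<noteq> 0" using w3 by auto
  have w2: "\<omega>^2 \<noteq> 1" "\<omega>^2 \<noteq> \<omega>" using w1 w0 w3 by (auto simp: power2_eq_square power3_eq_cube)
  define U where "U = {a :: 'a. a ^ 3 = 1}"
  have U: "U = {\<omega>, \<omega>^2, 1}"
  proof -
    have "a = 1 \<or> a = \<omega> \<or> a = \<omega>^2" if "a ^ 3 = 1" for a
    proof -
      have "(a - 1) * ((a - \<omega>) * (a - \<omega>^2)) = a^3 - 1"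
        by (simp add: power2_eq_square power3_eq_cube w algebra_simps)
      then show ?thesis using that by auto
    qed
    moreover have "(\<omega>^2)^3 = 1" using w3 by (metis power_mult mult.commute power_one)
    ultimately show ?thesis using w3 by (auto simp: U_def)
  qed
  have cU: "card U = 3" "finite U" using w1 w2 by (auto simp: U)
  have U0: "a \<noteq> 0" if "a \<in> U" for a using that by (auto simp: U_def)
  \<comment> \<open>As 3 divides n - 1, the condition a^(n-1) = 1 follows from a^3 = 1.\<close>
  have "{a :: 'a. a ^ Suc m = 1 \<and> a ^ 3 = 1} = U"
    using assms by (auto simp: U_def power_mult elim!: dvdE simp del: power_Suc)
  then have C: "carrier (Aut (complex_fold_A2 (Suc (Suc m)))) = A2_diag ` U \<union> A2_anti ` U"
    unfolding carrier_Aut_A2 by simp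
  \<comment> \<open>The group acts faithfully on these three points, the orbit of \<open>(1, 1)\<close>.\<close>
  define S where "S = (\<lambda>u. (u, u^2)) ` U"
  obtain p where p: "bij_betw p {1..3::nat} U"
    using ex_bij_betw_nat_finite_1[of U] cU by metis
  have bS: "bij_betw (\<lambda>u. (u, u^2)) U S" by (auto simp: S_def bij_betw_def inj_on_def)
  have mU: "a * b \<in> U" if "a \<in> U" "b \<in> U" for a b
    using that by (simp add: U_def power_mult_distrib)
  have a4: "(a^2)^2 = a" if "a \<in> U" for a using that by (simp add: U_def eval_nat_numeral)
  show ?thesis
  proof (rule is_iso_sym_group_if_faithful[OF Aut_mult bij_betw_trans[OF p bS]])
    fix \<phi> :: "'a \<times> 'a \<Rightarrow> 'a \<times> 'a"
    assume \<phi>: "\<phi> \<in> carrier (Aut (complex_fold_A2 (Suc (Suc m))))"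
    show "\<phi> ` S \<subseteq> S"
    proof
      fix y assume "y \<in> \<phi> ` S"
      then obtain u where u: "u \<in> U" "y = \<phi> (u, u^2)" by (auto simp: S_def)
      from \<phi> obtain a where a: "a \<in> U" "\<phi> = A2_diag a \<or> \<phi> = A2_anti a"
        unfolding C by blast
      have au: "a * u \<in> U" by (rule mU[OF a(1) u(1)])
      then have au2: "(a * u)^2 \<in> U" by (simp add: power2_eq_square mU)
      from a(2) show "y \<in> S"
      proof
        assume "\<phi> = A2_diag a"
        then have "y = (a * u, (a * u)^2)" using u(2) by (simp add: A2_diag_def power_mult_distrib)
        then show ?thesis using au by (simp add: S_def)
      next
        assume "\<phi> = A2_anti a"
        then have "y = ((a * u)^2, ((a * u)^2)^2)"
          unfolding a4[OF au] using u(2) by (simp add: A2_anti_def power_mult_distrib)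
        then show ?thesis using au2 unfolding S_def by (rule image_eqI)
      qed
    qed
    have "bij \<phi>" using \<phi> by (auto simp: Aut_carrier_iff intro: affine_auts_bij)
    then show "inj_on \<phi> S" by (auto simp: bij_def intro: inj_on_subset)
  next
    fix \<phi> \<psi> :: "'a \<times> 'a \<Rightarrow> 'a \<times> 'a"
    assume *: "\<phi> \<in> carrier (Aut (complex_fold_A2 (Suc (Suc m))))"
      "\<psi> \<in> carrier (Aut (complex_fold_A2 (Suc (Suc m))))" "\<And>x. x \<in> S \<Longrightarrow> \<phi> x = \<psi> x"
    have "(1, 1) \<in> S" "(\<omega>, \<omega>^2) \<in> S" by (auto simp: S_def U)
    then have eq: "\<phi> (1, 1) = \<psi> (1, 1)" "\<phi> (\<omega>, \<omega>^2) = \<psi> (\<omega>, \<omega>^2)" using *(3) by auto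
    \<comment> \<open>Agreement at (1, 1) gives a = b^2, and then agreement at the second point
      gives \<omega> = \<omega>^2.\<close>
    have no: False if "a \<in> U" "A2_diag a (1, 1) = A2_anti b (1, 1)"
      "A2_diag a (\<omega>, \<omega>^2) = A2_anti b (\<omega>, \<omega>^2)" for a b
      using that U0[OF that(1)] w2 by (auto simp: A2_diag_def A2_anti_def)
    from *(1,2) consider a b where "\<phi> = A2_diag a" "\<psi> = A2_diag b"
      | a b where "\<phi> = A2_anti a" "\<psi> = A2_anti b"
      | a b where "\<phi> = A2_diag a" "\<psi> = A2_anti b" "a \<in> U"
      | a b where "\<phi> = A2_anti b" "\<psi> = A2_diag a" "a \<in> U"
      unfolding C by blast
    then show "\<phi> = \<psi>"
    proof cases
      case 1
      then show ?thesis using eq by (simp add: A2_diag_def)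
    next
      case 2
      then show ?thesis using eq by (simp add: A2_anti_def)
    next
      case 3
      then show ?thesis using eq no by metis
    next
      case 4
      then show ?thesis using eq no by metis
    qed
  next
    have "A2_diag ` U \<inter> A2_anti ` U = {}" using A2_diag_neq_anti U0 by blast
    then show "card (carrier (Aut (complex_fold_A2 (Suc (Suc m)) :: 'a \<times> 'a \<Rightarrow> _))) = fact 3"
      unfolding C using cU
      by (simp add: card_Un_disjoint card_image inj_on_subset[OF A2_diag_inj] inj_on_subset[OF A2_anti_inj] eval_nat_numeral)
  qed
qed

theorem theorem1p8:
  fixes n :: nat
  assumes "n \<ge> 2"
  shows
    "([n = 1] (mod 3) \<longrightarrow>
        Aut (fold_A2 n :: 'a \<times> 'a \<Rightarrow> 'a::{alg_closed_field, field_char_0} \<times> 'a) \<cong> sym_group 3)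
     \<and> (\<not> [n = 1] (mod 3) \<longrightarrow>
        Aut (fold_A2 n :: 'a \<times> 'a \<Rightarrow> 'a \<times> 'a) \<cong> integer_mod_group 2)
     \<and> ([n = 1] (mod 2) \<longrightarrow>
        Aut (fold_B2 n :: 'a \<times> 'a \<Rightarrow> 'a \<times> 'a) \<cong> integer_mod_group 2)
     \<and> ([n = 0] (mod 2) \<longrightarrow>
        trivial_group (Aut (fold_B2 n :: 'a \<times> 'a \<Rightarrow> 'a \<times> 'a)))
     \<and> trivial_group (Aut (fold_G2 n :: 'a \<times> 'a \<Rightarrow> 'a \<times> 'a))"
proof -
  obtain m where n: "n = Suc (Suc m)"
    using assms by (metis add_2_eq_Suc le_Suc_ex)
  have mod3: "[n = 1] (mod 3) \<longleftrightarrow> 3 dvd Suc m"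
    unfolding n cong_def by presburger
  have mod2: "[n = 1] (mod 2) \<longleftrightarrow> odd m" "[n = 0] (mod 2) \<longleftrightarrow> even m"
    unfolding n cong_def by presburger+
  show ?thesis
    unfolding mod3 mod2 unfolding n
    using iso_trans[OF Aut_fold_A2_iso Aut_A2_S3] iso_trans[OF Aut_fold_A2_iso Aut_A2_mu2]
      Aut_B2_odd Aut_B2_even trivial_Aut_G2
    by blast
qed

end
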